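(* Let $(X,\sigma)$ be a classical symbolic system (a two-sided subshift $X\subset\Lambda^{\mathbb Z}$ or a one-sided subshift $X\subset\Lambda^{\mathbb N_0}$ over a finite alphabet $\Lambda$) and let $\mathcal U\supset\mathcal M^{\mathsf{erg}}_\sigma(X)$ be an open set in $\mathcal B^*(X)\cup\mathcal M(X)$ (with the metric $d^*$). For every $\varepsilon>0$ there exists $n_0\in\mathbb N$ such that every block $B\in\mathcal B^*(X)$ of length at least $n_0$ may be decomposed as a concatenation of blocks $B=A_1B_1A_2B_2\dots A_rB_rA_{r+1}$ such that the blocks $B_1,\dots,B_r$ are $\mathcal U$-ergodic (i.e. belong to $\mathcal U$) and $\sum_{j=1}^r|B_j|\ge(1-\varepsilon)|B|$. (The blocks $A_j$ may be empty.)
   Context: $\Lambda$ is a finite discrete set. The shift is $(\sigma(x))(i)=x(i+1)$. A two-sided (one-sided) subshift is a closed subset $X$ of $\Lambda^{\mathbb Z}$ (resp. $\Lambda^{\mathbb N_0}$) invariant under $\sigma$ (i.e. $\sigma(X)=X$ in the two-sided case, $\sigma(X)\subset X$ in the one-sided case). Coordinates $i$ range over $\mathbb Z$ (resp. $\mathbb N_0$). A block of length $k$ is an element $B\in\Lambda^k$, $|B|=k$. $\mathcal B^*(X)$ is the set of all blocks occurring in elements of $X$, i.e. blocks of the form $x|_{[i,i+k)}$ with $x\in X$ (regarded as elements of $\Lambda^k$). For $B\in\Lambda^k$, $C\in\Lambda^l$ with $l\le k$, $\mathrm{Fr}_B(C)=\frac1k|\{i\in[0,k-l]: B|_{[i,i+l)}=C\}|$;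 if $l>k$, $\mathrm{Fr}_B(C)=0$. $\mathcal M(X)$ is the set of Borel probability measures on $X$, $\mathcal M_\sigma(X)$ the shift-invariant ones, $\mathcal M^{\mathsf{erg}}_\sigma(X)$ the ergodic ones. $[C]=\{x\in X: x|_{[0,l)}=C\}$ for $C\in\Lambda^l$. For $p\in\mathcal B^*(X)\cup\mathcal M(X)$ put $p(C)=\mathrm{Fr}_p(C)$ if $p$ is a block and $p(C)=p([C])$ if $p$ is a measure. The metric on $\mathcal B^*(X)\cup\mathcal M(X)$ is $d^*(p,q)=\sum_{l=1}^{\infty}2^{-l}\sum_{C\in\Lambda^l}|p(C)-q(C)|$. *)

theory Defs
  imports "HOL-Probability.Probability"
begin

text \<open>
  The alphabet is a finite type with the discrete topology, so that the library topology on
  \<open>'i \<Rightarrow> 'a\<close> is the product topology. Configurations are functions \<open>'i \<Rightarrow> 'a\<close> with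
  \<open>'i = int\<close> (two-sided) or \<open>'i = nat\<close> (one-sided).
\<close>

definition shift_map :: "('i::semiring_1 \<Rightarrow> 'a) \<Rightarrow> 'i \<Rightarrow> 'a" where
  "shift_map x = (\<lambda>i. x (i + 1))"

definition two_sided_subshift :: "(int \<Rightarrow> 'a::{finite,discrete_topology}) set \<Rightarrow> bool" where
  "two_sided_subshift X \<longleftrightarrow> closed X \<and> shift_map ` X = X"

definition one_sided_subshift :: "(nat \<Rightarrow> 'a::{finite,discrete_topology}) set \<Rightarrow> bool" where
  "one_sided_subshift X \<longleftrightarrow> closed X \<and> shift_map ` X \<subseteq> X"

text \<open>The block \<open>x|[i, i + k)\<close>, as a list of length \<open>k\<close>.\<close>

definition window :: "('i::semiring_1 \<Rightarrow> 'a) \<Rightarrow> 'i \<Rightarrow> nat \<Rightarrow> 'a list" where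
  "window x i k = map (\<lambda>j. x (i + of_nat j)) [0..<k]"

text \<open>Blocks have positive length; the empty word is not counted as a block.\<close>

definition blocks :: "('i::semiring_1 \<Rightarrow> 'a) set \<Rightarrow> 'a list set" where
  "blocks X = {window x i k | x i k. x \<in> X \<and> k \<ge> 1}"

definition block_freq :: "'a list \<Rightarrow> 'a list \<Rightarrow> real" where
  "block_freq B C =
     (if length C \<le> length B
      then real (card {i \<in> {0..length B - length C}. take (length C) (drop i B) = C})
             / real (length B)
      else 0)"

definition cylinder :: "('i::semiring_1 \<Rightarrow> 'a) set \<Rightarrow> 'a list \<Rightarrow> ('i \<Rightarrow> 'a) set" where
  "cylinder X C = {x \<in> X. window x 0 (length C) = C}"

definition borel_prob_measures ::
    "('i \<Rightarrow> 'a::topological_space) set \<Rightarrow> ('i \<Rightarrow> 'a) measure set" where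
  "borel_prob_measures X = {\<mu>. prob_space \<mu> \<and> sets \<mu> = sets (restrict_space borel X)}"

definition invariant_measures ::
    "('i::semiring_1 \<Rightarrow> 'a::topological_space) set \<Rightarrow> ('i \<Rightarrow> 'a) measure set" where
  "invariant_measures X = {\<mu> \<in> borel_prob_measures X.
     \<forall>A \<in> sets \<mu>. measure \<mu> (shift_map -` A \<inter> X) = measure \<mu> A}"

definition ergodic_measures ::
    "('i::semiring_1 \<Rightarrow> 'a::topological_space) set \<Rightarrow> ('i \<Rightarrow> 'a) measure set" where
  "ergodic_measures X = {\<mu> \<in> invariant_measures X.
     \<forall>A \<in> sets \<mu>. shift_map -` A \<inter> X = A \<longrightarrow> measure \<mu> A = 0 \<or> measure \<mu> A = 1}"

text \<open>
  The union of blocks and measures is a disjoint one, hence a sum type: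
  \<open>Inl\<close> injects blocks and \<open>Inr\<close> injects measures.
\<close>

definition blocks_and_measures ::
    "('i::semiring_1 \<Rightarrow> 'a::topological_space) set \<Rightarrow> ('a list + ('i \<Rightarrow> 'a) measure) set" where
  "blocks_and_measures X = blocks X <+> borel_prob_measures X"

definition value_on ::
    "('i::semiring_1 \<Rightarrow> 'a) set \<Rightarrow> 'a list + ('i \<Rightarrow> 'a) measure \<Rightarrow> 'a list \<Rightarrow> real" where
  "value_on X p C =
     (case p of Inl B \<Rightarrow> block_freq B C | Inr \<mu> \<Rightarrow> measure \<mu> (cylinder X C))"

text \<open>The index \<open>l\<close> starts at \<open>0\<close> here, so the words \<open>C\<close> have length \<open>Suc l\<close>.\<close>

definition d_star ::
    "('i::semiring_1 \<Rightarrow> 'a::finite) set \<Rightarrow> 'a list + ('i \<Rightarrow> 'a) measure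
       \<Rightarrow> 'a list + ('i \<Rightarrow> 'a) measure \<Rightarrow> real" where
  "d_star X p q =
     (\<Sum>l. (1 / 2) ^ Suc l * (\<Sum>C | length C = Suc l. \<bar>value_on X p C - value_on X q C\<bar>))"

text \<open>
  Openness is spelled out with balls: for two-sided \<open>X\<close>, \<open>d_star\<close> sees only the nonnegative
  coordinates, so on non-invariant measures it is merely a pseudometric and the library
  locale \<open>Metric_space\<close> does not apply.
\<close>

definition d_star_open ::
    "('i::semiring_1 \<Rightarrow> 'a::{finite,topological_space}) set
       \<Rightarrow> ('a list + ('i \<Rightarrow> 'a) measure) set \<Rightarrow> bool" where
  "d_star_open X U \<longleftrightarrow> U \<subseteq> blocks_and_measures X \<and>
     (\<forall>p \<in> U. \<exists>\<delta>>0. \<forall>q \<in> blocks_and_measures X. d_star X p q < \<delta> \<longrightarrow> q \<in> U)"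

end

theory Submission
  imports Defs
begin

text \<open>
  Fix \<open>N\<close> and cut a long block \<open>B\<close> greedily from the left: at each position take a subblock from
  \<open>U\<close> of length at most \<open>N\<close> if there is one, otherwise skip one letter. The skipped positions are
  those from which no such subblock starts, so if arbitrarily long blocks could not be decomposed,
  a limit of empirical averages would be a shift-invariant finitely additive set function \<open>m0\<close> on
  the clopen sets, giving mass at least \<open>\<epsilon> / 2\<close> to each of the decreasing clopen sets
  \<open>unvisited N\<close> of points having no initial block in \<open>U\<close> of length at most \<open>N\<close>. The functional
  \<open>m \<mapsto> inf m (unvisited N)\<close> is affine and upper semicontinuous on the compact convex set of
  invariant contents, hence is maximised at an extreme point. By compactness this point extends to
  a Borel measure \<open>\<mu>\<close>; extremality makes it ergodic, and it also yields a weak law of large numbers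
  for visits to clopen sets. So most points have long initial blocks close to \<open>\<mu> \<in> U\<close>, which
  contradicts the positive mass of all \<open>unvisited N\<close>. Neither the ergodic decomposition nor the
  pointwise ergodic theorem is needed.
\<close>

section \<open>Maximisers on compact sets\<close>

text \<open>Cantor's intersection theorem: a finite subfamily of a decreasing sequence has a
  smallest member, so the finite intersection property holds. Closedness is a separate hypothesis
  because the space is not assumed Hausdorff.\<close>

lemma compact_Inter_decseq_nonempty:
  fixes F :: "nat \<Rightarrow> 'x::topological_space set"
  assumes "compact (F 0)" "\<And>n. closed (F n)" "\<And>n. F n \<noteq> {}" "decseq F"
  shows "(\<Inter>n. F n) \<noteq> {}"
proof -
  have "F 0 \<inter> \<Inter>(range F) \<noteq> {}"
  proof (rule compact_imp_fip)
    show "compact (F 0)" by fact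
    show "closed T" if "T \<in> range F" for T
      using that assms(2) by auto
    fix F' assume "finite F'" "F' \<subseteq> range F"
    then obtain I where I: "finite I" "F' = F ` I"
      by (meson finite_subset_image)
    \<comment> \<open>Inserting 0 keeps the maximum defined for an empty subfamily.\<close>
    define k where "k = Max (insert 0 I)"
    have "F k \<subseteq> F i" if "i \<in> insert 0 I" for i
      using that I unfolding k_def by (intro decseqD[OF assms(4)] Max_ge) auto
    then have "F k \<subseteq> F 0 \<inter> \<Inter>F'" using I by auto
    then show "F 0 \<inter> \<Inter>F' \<noteq> {}" using assms(3)[of k] by blast
  qed
  then show ?thesis by auto
qed

text \<open>Upper semicontinuity is expressed by closed superlevel sets. Among finitely many levels
  \<open>f y\<close> the largest is attained at a point lying in all the corresponding superlevel
  sets; a point common to all superlevel sets over \<open>K\<close> is a maximiser.\<close>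

lemma usc_attains_sup:
  fixes f :: "'x::topological_space \<Rightarrow> real"
  assumes "compact K" "K \<noteq> {}" and usc: "\<And>s. closed {x \<in> K. s \<le> f x}"
  shows "\<exists>x\<in>K. \<forall>y\<in>K. f y \<le> f x"
proof -
  have "K \<inter> \<Inter>((\<lambda>y. {x \<in> K. f y \<le> f x}) ` K) \<noteq> {}"
  proof (rule compact_imp_fip)
    show "compact K" by fact
    show "closed T" if "T \<in> (\<lambda>y. {x \<in> K. f y \<le> f x}) ` K" for T
      using that usc by auto
    fix F' assume "finite F'" "F' \<subseteq> (\<lambda>y. {x \<in> K. f y \<le> f x}) ` K"
    then obtain I where I: "finite I" "I \<subseteq> K" "F' = (\<lambda>y. {x \<in> K. f y \<le> f x}) ` I"
      by (meson finite_subset_image)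
    show "K \<inter> \<Inter>F' \<noteq> {}"
    proof (cases "I = {}")
      case True
      then show ?thesis using assms(2) I by auto
    next
      case False
      then have "Max (f ` I) \<in> f ` I" using I by simp
      then obtain z where z: "z \<in> I" "f z = Max (f ` I)" by force
      then have "\<forall>y\<in>I. f y \<le> f z" using I by simp
      then have "z \<in> K \<inter> \<Inter>F'" using I z by auto
      then show ?thesis by blast
    qed
  qed
  then show ?thesis by auto
qed

text \<open>Maximising \<open>f 0\<close>, then \<open>f 1\<close> among the maximisers, and so on, replaces the appeal to
  Krein and Milman: every maximiser set is a face, so their intersection only contains points
  that cannot be split by the functions \<open>f k\<close>.\<close>

lemma lexicographic_maximiser:
  fixes f :: "nat \<Rightarrow> 'x::topological_space \<Rightarrow> real"
  assumes K: "compact K" "closed K" "K \<noteq> {}" and usc: "\<And>k s. closed {x \<in> K. s \<le> f k x}"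
  shows "\<exists>m\<in>K. (\<forall>x\<in>K. f 0 x \<le> f 0 m) \<and>
    (\<forall>a\<in>K. \<forall>b\<in>K. \<forall>t. 0 < t \<longrightarrow> t < 1 \<longrightarrow>
       (\<forall>k. f k m = t * f k a + (1 - t) * f k b) \<longrightarrow> (\<forall>k. f k a = f k m))"
proof -
  define G where "G = rec_nat K (\<lambda>k S. {x \<in> S. \<forall>y\<in>S. f k y \<le> f k x})"
  have G0: "G 0 = K" and GS: "\<And>k. G (Suc k) = {x \<in> G k. \<forall>y\<in>G k. f k y \<le> f k x}"
    unfolding G_def by simp_all
  have dec: "decseq G" by (rule decseq_SucI) (auto simp: GS)
  then have subK: "G k \<subseteq> K" for k using G0 by (metis decseqD le0)
  \<comment> \<open>Once a maximiser \<open>z\<close> exists, the next set is the superlevel set of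
    \<open>f k\<close> at level \<open>f k z\<close> inside \<open>G k\<close>, so closedness and
    compactness survive.\<close>
  have GC: "compact (G k) \<and> closed (G k) \<and> G k \<noteq> {}" for k
  proof (induction k)
    case 0
    then show ?case using G0 K by simp
  next
    case (Suc k)
    have usc': "closed {x \<in> G k. s \<le> f k x}" for s
    proof -
      have "{x \<in> G k. s \<le> f k x} = G k \<inter> {x \<in> K. s \<le> f k x}" using subK by auto
      moreover have "closed (G k \<inter> {x \<in> K. s \<le> f k x})"
        using usc Suc by (intro closed_Int) auto
      ultimately show ?thesis by (simp only:)
    qed
    from usc_attains_sup[OF _ _ this] Suc obtain z where
      z: "z \<in> G k" "\<forall>y\<in>G k. f k y \<le> f k z" by auto
    then have "G (Suc k) = {x \<in> G k. f k z \<le> f k x}"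
      unfolding GS by (meson order_trans)
    then have cl: "closed (G (Suc k))" using usc' by simp
    then have "compact (G k \<inter> G (Suc k))" using Suc by (intro compact_Int_closed) auto
    moreover have "G k \<inter> G (Suc k) = G (Suc k)" by (auto simp: GS)
    ultimately show ?case using z GS cl by auto
  qed
  have "(\<Inter>k. G k) \<noteq> {}"
    by (rule compact_Inter_decseq_nonempty) (use GC dec in auto)
  then obtain m where m: "\<And>k. m \<in> G k" by auto
  \<comment> \<open>A proper weighted mean of two numbers at most \<open>f k m\<close> equals
    \<open>f k m\<close> only if both do, so a splitting of \<open>m\<close> inside \<open>K\<close>
    stays inside every \<open>G k\<close>.\<close>
  have face: "a \<in> G k \<and> b \<in> G k"
    if ab: "a \<in> K" "b \<in> K" and t: "0 < t" "t < 1"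
      and eq: "\<And>k. f k m = t * f k a + (1 - t) * f k b" for a b t k
  proof (induction k)
    case 0
    then show ?case using ab G0 by simp
  next
    case (Suc k)
    have mx: "\<forall>y\<in>G k. f k y \<le> f k m" using m[of "Suc k"] unfolding GS by simp
    then have le: "f k a \<le> f k m" "f k b \<le> f k m" using Suc by auto
    have "t * (f k m - f k a) + (1 - t) * (f k m - f k b) = 0"
      using eq[of k] by (simp add: algebra_simps)
    moreover have "0 \<le> t * (f k m - f k a)" "0 \<le> (1 - t) * (f k m - f k b)"
      using t le by auto
    ultimately have "t * (f k m - f k a) = 0" "(1 - t) * (f k m - f k b) = 0" by linarith+
    then have "f k a = f k m" "f k b = f k m" using t by auto
    then show ?case using Suc mx unfolding GS by auto
  qed
  show ?thesis
  proof (intro bexI[of _ m] conjI ballI allI impI)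
    show "m \<in> K" using m[of 0] G0 by simp
    show "f 0 x \<le> f 0 m" if "x \<in> K" for x using m[of "Suc 0"] that unfolding GS G0 by simp
    fix a b t k
    assume "a \<in> K" "b \<in> K" "0 < t" "t < 1" "\<forall>k. f k m = t * f k a + (1 - t) * f k b"
    then have "a \<in> G (Suc k)" "m \<in> G (Suc k)" using face m by auto
    then show "f k a = f k m" unfolding GS by (auto intro: antisym)
  qed
qed

section \<open>Finitely additive contents on clopen sets\<close>

text \<open>Clopenness is relative to \<open>X\<close>, which makes these sets an algebra on
  \<open>X\<close>; for compact sets of configurations they are the finite unions of cylinder-like
  boxes.\<close>

definition clopens :: "'x::topological_space set \<Rightarrow> 'x set set" where
  "clopens X = {A. openin (top_of_set X) A \<and> closedin (top_of_set X) A}"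

text \<open>The bounds are imposed on all sets, clopen or not, so that the contents form a closed
  subset of a product of unit intervals.\<close>

definition contents :: "'x::topological_space set \<Rightarrow> ('x set \<Rightarrow> real) set" where
  "contents X = {m. (\<forall>A. 0 \<le> m A \<and> m A \<le> 1) \<and> m X = 1 \<and>
     (\<forall>A \<in> clopens X. \<forall>B \<in> clopens X. A \<inter> B = {} \<longrightarrow> m (A \<union> B) = m A + m B)}"

lemma clopens_subset: "A \<in> clopens X \<Longrightarrow> A \<subseteq> X"
  unfolding clopens_def using openin_imp_subset by blast

lemma clopens_simps [simp, intro]: "{} \<in> clopens X" "X \<in> clopens X"
  unfolding clopens_def by auto

lemma clopens_Un: "A \<in> clopens X \<Longrightarrow> B \<in> clopens X \<Longrightarrow> A \<union> B \<in> clopens X"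
  and clopens_Int: "A \<in> clopens X \<Longrightarrow> B \<in> clopens X \<Longrightarrow> A \<inter> B \<in> clopens X"
  and clopens_Diff: "A \<in> clopens X \<Longrightarrow> B \<in> clopens X \<Longrightarrow> A - B \<in> clopens X"
  unfolding clopens_def by (simp_all add: openin_Un closedin_Un openin_Int closedin_Int openin_diff closedin_diff)

lemma clopens_UN: "finite I \<Longrightarrow> (\<And>i. i \<in> I \<Longrightarrow> A i \<in> clopens X) \<Longrightarrow> (\<Union>i\<in>I. A i) \<in> clopens X"
  by (induction I rule: finite_induct) (auto intro: clopens_Un)

lemma clopens_restrict: "open A \<Longrightarrow> closed A \<Longrightarrow> X \<inter> A \<in> clopens X"
  unfolding clopens_def by (simp add: closedin_closed_Int openin_open_Int)

lemma clopens_algebra: "algebra X (clopens X)"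
  unfolding algebra_iff_Un
  by (intro conjI ballI clopens_Un clopens_Diff clopens_simps subsetI PowI clopens_subset)

lemma clopens_compact: "compact X \<Longrightarrow> A \<in> clopens X \<Longrightarrow> compact A"
  unfolding clopens_def by (auto intro: closedin_compact)

lemma clopens_preimage:
  assumes "continuous_on X T" "T ` X \<subseteq> X" "A \<in> clopens X"
  shows "T -` A \<inter> X \<in> clopens X"
proof -
  have T: "T \<in> X \<rightarrow> X" using assms(2) by auto
  have "openin (top_of_set X) (X \<inter> T -` A)"
    using assms(3) by (intro continuous_openin_preimage[OF assms(1) T]) (simp add: clopens_def)
  moreover have "closedin (top_of_set X) (X \<inter> T -` A)"
    using continuous_on_closed_gen[OF T] assms(1,3) by (simp add: clopens_def)
  ultimately show ?thesis unfolding clopens_def by (simp add: Int_commute)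
qed

lemma contents_closed: "closed (contents X)"
proof -
  have eq: "contents X = (\<Inter>A. {m. 0 \<le> m A} \<inter> {m. m A \<le> 1}) \<inter> {m. m X = 1} \<inter>
     (\<Inter>A\<in>clopens X. \<Inter>B\<in>{B \<in> clopens X. A \<inter> B = {}}. {m. m (A \<union> B) = m A + m B})"
    unfolding contents_def by fastforce
  show ?thesis
    unfolding eq
    by (intro closed_Int closed_INT ballI closed_Collect_le closed_Collect_eq continuous_intros)
      auto
qed

text \<open>Tychonoff's theorem for the topology of pointwise convergence.\<close>

lemma contents_compact: "compact (contents X)"
proof -
  have "compact (Pi\<^sub>E UNIV (\<lambda>_::'a set. {0..1::real}))"
    using compactin_PiE[of "\<lambda>_. euclidean" UNIV "\<lambda>_::'a set. {0..1::real}"]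
    by (simp add: euclidean_product_topology)
  moreover have "contents X \<subseteq> Pi\<^sub>E UNIV (\<lambda>_. {0..1})" by (auto simp: contents_def)
  ultimately show ?thesis using contents_closed
    by (metis compact_Int_closed inf.absorb2)
qed

lemma
  assumes "m \<in> contents X"
  shows contents_nonneg: "0 \<le> m A" and contents_le_1: "m A \<le> 1" and contents_space: "m X = 1"
    and contents_add: "A \<in> clopens X \<Longrightarrow> B \<in> clopens X \<Longrightarrow> A \<inter> B = {} \<Longrightarrow> m (A \<union> B) = m A + m B"
  using assms unfolding contents_def by auto

lemma contents_empty: "m \<in> contents X \<Longrightarrow> m {} = 0"
  using contents_add[of m X "{}" "{}"] by auto

lemma contents_mono:
  assumes m: "m \<in> contents X" and "A \<in> clopens X" "B \<in> clopens X" "A \<subseteq> B"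
  shows "m A \<le> m B"
proof -
  have "m (A \<union> (B - A)) = m A + m (B - A)"
    using assms clopens_Diff by (intro contents_add[OF m]) auto
  moreover have "A \<union> (B - A) = B" using assms by auto
  ultimately show ?thesis using contents_nonneg[OF m, of "B - A"] by simp
qed

lemma clopens_closed: "closed X \<Longrightarrow> A \<in> clopens X \<Longrightarrow> closed A"
  unfolding clopens_def using closedin_closed_trans by blast

text \<open>Continuity at the empty set is automatic: clopen subsets of \<open>X\<close> are
  compact, so a decreasing sequence of them with empty intersection reaches the empty set.
  Caratheodory's theorem then applies.\<close>

lemma content_extends_to_measure:
  fixes X :: "'x::topological_space set"
  assumes X: "compact X" "closed X" and m: "m \<in> contents X"
  shows "\<exists>\<mu>. prob_space \<mu> \<and> space \<mu> = X \<and> sets \<mu> = sigma_sets X (clopens X) \<and>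
    (\<forall>A \<in> clopens X. measure \<mu> A = m A)"
proof -
  interpret algebra X "clopens X" by (rule clopens_algebra)
  have "\<exists>\<mu>::'x set \<Rightarrow> ennreal. (\<forall>A\<in>clopens X. \<mu> A = ennreal (m A)) \<and>
      measure_space X (sigma_sets X (clopens X)) \<mu>"
  proof (rule caratheodory_empty_continuous)
    show "positive (clopens X) (\<lambda>A. ennreal (m A))"
      using contents_empty[OF m] by (simp add: positive_def)
    show "additive (clopens X) (\<lambda>A. ennreal (m A))"
      using contents_add[OF m] contents_nonneg[OF m]
      by (auto simp: additive_def ennreal_plus)
    fix A :: "nat \<Rightarrow> 'x set"
    assume A: "range A \<subseteq> clopens X" "decseq A" "(\<Inter>i. A i) = {}"
    have "\<exists>n. A n = {}"
      using compact_Inter_decseq_nonempty[of A] A clopens_compact[OF X(1)] clopens_closed[OF X(2)] by blast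
    then obtain n where n: "A n = {}" by auto
    have "\<forall>\<^sub>F i in sequentially. ennreal (m (A i)) = 0"
    proof (rule eventually_sequentiallyI)
      fix i assume "n \<le> i"
      then have "A i = {}" using A(2) n decseqD by blast
      then show "ennreal (m (A i)) = 0" using contents_empty[OF m] by simp
    qed
    then show "(\<lambda>i. ennreal (m (A i))) \<longlonglongrightarrow> 0" by (rule tendsto_eventually)
  qed auto
  then obtain f :: "'x set \<Rightarrow> ennreal" where f: "\<And>A. A \<in> clopens X \<Longrightarrow> f A = ennreal (m A)"
      "measure_space X (sigma_sets X (clopens X)) f"
    by auto
  define \<mu> where "\<mu> = measure_of X (clopens X) f"
  have sub: "clopens X \<subseteq> Pow X" using clopens_subset by auto
  have sp: "space \<mu> = X" "sets \<mu> = sigma_sets X (clopens X)" unfolding \<mu>_def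
    using sub by (simp_all add: space_measure_of sets_measure_of)
  have em: "emeasure \<mu> A = ennreal (m A)" if "A \<in> clopens X" for A
    using emeasure_measure_of[OF \<mu>_def sub, of A] f that sp
    unfolding measure_space_def by auto
  have "prob_space \<mu>" by (rule prob_spaceI) (simp add: sp em contents_space[OF m])
  moreover have "measure \<mu> A = m A" if "A \<in> clopens X" for A
    using em[OF that] contents_nonneg[OF m] by (simp add: measure_def)
  ultimately show ?thesis using sp by blast
qed

section \<open>Finite coordinate boxes: basis, countability, Borel sets\<close>

definition coordinate_box :: "('i \<times> 'a) set \<Rightarrow> ('i \<Rightarrow> 'a) set" where
  "coordinate_box F = {x. \<forall>p\<in>F. x (fst p) = snd p}"

lemma coordinate_box_clopen:
  fixes F :: "('i \<times> 'a::discrete_topology) set"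
  assumes "finite F"
  shows "open (coordinate_box F)" and "closed (coordinate_box F)"
proof -
  have eq: "coordinate_box F = (\<Inter>p\<in>F. (\<lambda>x. x (fst p)) -` {snd p})"
    unfolding coordinate_box_def by auto
  have op: "open ((\<lambda>x::'i \<Rightarrow> 'a. x i) -` S)" for i S
    by (intro open_vimage discrete_topology_class.open_discrete continuous_on_product_coordinates)
  have cl: "closed ((\<lambda>x::'i \<Rightarrow> 'a. x i) -` S)" for i S
    using op[of i "- S"] by (simp add: closed_def vimage_Compl)
  show "open (coordinate_box F)" "closed (coordinate_box F)"
    unfolding eq using assms by (intro open_INT closed_INT ballI op cl; assumption)+
qed

text \<open>A basic open product constrains only finitely many coordinates; prescribing the values
  of \<open>x\<close> there gives the box.\<close>

lemma coordinate_box_basis: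
  fixes U :: "('i \<Rightarrow> 'a::discrete_topology) set"
  assumes "open U" "x \<in> U"
  obtains F where "finite F" "x \<in> coordinate_box F" "coordinate_box F \<subseteq> U"
proof -
  obtain V where V: "finite {i. V i \<noteq> UNIV}" "x \<in> Pi\<^sub>E UNIV V" "Pi\<^sub>E UNIV V \<subseteq> U"
    using product_topology_open_contains_basis[of "\<lambda>_. euclidean" UNIV U x] assms
    unfolding open_fun_def by auto
  define F where "F = (\<lambda>i. (i, x i)) ` {i. V i \<noteq> UNIV}"
  have "coordinate_box F \<subseteq> Pi\<^sub>E UNIV V"
  proof (rule subsetI)
    fix y assume y: "y \<in> coordinate_box F"
    have "y i \<in> V i" for i
      using y V(2) by (cases "V i = UNIV") (auto simp: coordinate_box_def F_def PiE_iff)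
    then show "y \<in> Pi\<^sub>E UNIV V" by (simp add: PiE_iff)
  qed
  then show thesis
    using V by (intro that[of F]) (auto simp: F_def coordinate_box_def)
qed

lemma countable_boxes: "countable {F :: ('i::countable \<times> 'a::finite) set. finite F}"
  by (rule countable_Collect_finite)

lemma openin_Union_boxes:
  fixes X :: "('i \<Rightarrow> 'a::discrete_topology) set"
  assumes "openin (top_of_set X) A"
  shows "A = (\<Union>F \<in> {F. finite F \<and> X \<inter> coordinate_box F \<subseteq> A}. X \<inter> coordinate_box F)"
proof -
  obtain U where U: "open U" "A = X \<inter> U" using assms openin_open by metis
  show ?thesis
  proof (intro equalityI subsetI)
    fix x assume x: "x \<in> A"
    then obtain F where "finite F" "x \<in> coordinate_box F" "coordinate_box F \<subseteq> U"
      using coordinate_box_basis[OF U(1), of x] U(2) by (metis IntD2)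
    then show "x \<in> (\<Union>F \<in> {F. finite F \<and> X \<inter> coordinate_box F \<subseteq> A}. X \<inter> coordinate_box F)"
      using x U(2) by (intro UN_I[of F]) auto
  qed blast
qed

text \<open>By compactness a clopen set is a union of finitely many boxes, and there are only
  countably many finite families of boxes.\<close>

lemma countable_clopens:
  fixes X :: "('i::countable \<Rightarrow> 'a::{finite,discrete_topology}) set"
  assumes "compact X"
  shows "countable (clopens X)"
proof -
  let ?\<C> = "(\<lambda>\<F>. \<Union>F\<in>\<F>. X \<inter> coordinate_box F) ` {\<F> :: ('i \<times> 'a) set set. finite \<F> \<and> \<F> \<subseteq> {F. finite F}}"
  have "A \<in> ?\<C>" if A: "A \<in> clopens X" for A
  proof -
    let ?I = "{F. finite F \<and> X \<inter> coordinate_box F \<subseteq> A}"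
    have eq: "A = (\<Union>F \<in> ?I. X \<inter> coordinate_box F)"
      using A openin_Union_boxes unfolding clopens_def by blast
    then have sub: "A \<subseteq> (\<Union>F \<in> ?I. coordinate_box F)" by blast
    obtain \<F> where \<F>: "\<F> \<subseteq> ?I" "finite \<F>" "A \<subseteq> (\<Union>F \<in> \<F>. coordinate_box F)"
    proof (rule compactE_image[OF clopens_compact[OF assms A] _ sub])
      show "open (coordinate_box T)" if "T \<in> ?I" for T
        using that by (auto intro: coordinate_box_clopen)
    qed
    then have "A = (\<Union>F \<in> \<F>. X \<inter> coordinate_box F)" using clopens_subset[OF A] by blast
    then show ?thesis using \<F> by blast
  qed
  moreover have "countable ?\<C>"
    by (intro countable_image countable_Collect_finite_subset countable_boxes)
  ultimately show ?thesis by (meson countable_subset subsetI)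
qed

text \<open>A relatively open set is the union of the boxes inside it, which are countably many, so
  the clopen sets generate all Borel sets. This makes the extension of a content a Borel measure on
  \<open>X\<close>.\<close>

lemma sigma_sets_clopens:
  fixes X :: "('i::countable \<Rightarrow> 'a::{finite,discrete_topology}) set"
  assumes "closed X"
  shows "sigma_sets X (clopens X) = sets (restrict_space borel X)"
proof -
  have sub: "clopens X \<subseteq> Pow X" using clopens_subset by auto
  have "X \<in> sigma_sets UNIV {S. open S}"
    using assms borel_closed sets_borel by blast
  then have "sets (restrict_space borel X) = sigma_sets X ((\<inter>) X ` {S. open S})"
    by (simp add: sets_restrict_space sets_borel sigma_sets_Int)
  moreover have "sigma_sets X ((\<inter>) X ` {S. open S}) \<subseteq> sigma_sets X (clopens X)"
  proof (rule sigma_sets_mono, rule subsetI)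
    fix A assume "A \<in> (\<inter>) X ` {S. open S}"
    then have "openin (top_of_set X) A" by (auto simp: openin_open_Int)
    note eq = openin_Union_boxes[OF this]
    let ?I = "{F. finite F \<and> X \<inter> coordinate_box F \<subseteq> A}"
    interpret sigma_algebra X "sigma_sets X (clopens X)"
      by (rule sigma_algebra_sigma_sets) (rule sub)
    have "countable ?I" by (rule countable_subset[OF _ countable_boxes]) auto
    then have "(\<Union>F \<in> ?I. X \<inter> coordinate_box F) \<in> sigma_sets X (clopens X)"
      by (intro countable_UN'') (auto intro!: clopens_restrict coordinate_box_clopen)
    then show "A \<in> sigma_sets X (clopens X)" using eq by simp
  qed
  moreover have "sigma_sets X (clopens X) \<subseteq> sigma_sets X ((\<inter>) X ` {S. open S})"
    by (rule sigma_sets_mono') (auto simp: clopens_def openin_open)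
  ultimately show ?thesis by simp
qed

lemma compact_UNIV_configurations: "compact (UNIV :: ('i \<Rightarrow> 'a::{finite,discrete_topology}) set)"
proof -
  have "compact (UNIV :: 'a set)" by (rule finite_imp_compact) simp
  then show ?thesis
    using compactin_PiE[of "\<lambda>_. euclidean" UNIV "\<lambda>_::'i. UNIV :: 'a set"]
    by (simp add: euclidean_product_topology)
qed

section \<open>Invariant contents\<close>

lemma funpow_in_invariant: "f ` X \<subseteq> X \<Longrightarrow> x \<in> X \<Longrightarrow> (f ^^ j) x \<in> X"
  by (induction j) auto

text \<open>Countability of the clopen algebra allows the evaluations on clopen sets to be listed as
  one sequence of functions, as \<open>lexicographic_maximiser\<close> requires.\<close>

locale clopen_system =
  fixes X :: "'x::topological_space set" and T :: "'x \<Rightarrow> 'x"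
  assumes compact_X: "compact X" and countable_clopens_X: "countable (clopens X)"
    and T_cont: "continuous_on X T" and T_X: "T ` X \<subseteq> X"
begin

definition pull :: "nat \<Rightarrow> 'x set \<Rightarrow> 'x set" where
  "pull j A = (T ^^ j) -` A \<inter> X"

definition invariant_contents :: "('x set \<Rightarrow> real) set" where
  "invariant_contents = {m \<in> contents X. \<forall>A \<in> clopens X. m (T -` A \<inter> X) = m A}"

text \<open>The Krylov-Bogoliubov average: the Cesaro mean of the images of \<open>q\<close> under
  the first \<open>n\<close> iterates of \<open>T\<close>, starting with the identity.\<close>

definition average :: "nat \<Rightarrow> ('x set \<Rightarrow> real) \<Rightarrow> 'x set \<Rightarrow> real" where
  "average n q A = (\<Sum>j<n. q (pull j A)) / n"

text \<open>The domination form of being an extreme point: \<open>\<eta> * m' \<le> m\<close> says that \<open>m\<close> is a convex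
  combination of \<open>m'\<close> and a remainder.\<close>

definition extremal :: "('x set \<Rightarrow> real) \<Rightarrow> bool" where
  "extremal m \<longleftrightarrow> m \<in> invariant_contents \<and>
     (\<forall>\<eta>>0. \<forall>m' \<in> invariant_contents. (\<forall>A \<in> clopens X. \<eta> * m' A \<le> m A) \<longrightarrow>
        (\<forall>A \<in> clopens X. m' A = m A))"

definition visit_rate :: "nat \<Rightarrow> 'x set \<Rightarrow> 'x \<Rightarrow> real" where
  "visit_rate n A x = card {j. j < n \<and> (T ^^ j) x \<in> A} / n"

lemma funpow_T_in: "x \<in> X \<Longrightarrow> (T ^^ j) x \<in> X"
  by (rule funpow_in_invariant[OF T_X])

lemma pull_T: "pull j (T -` A \<inter> X) = pull (Suc j) A"
  using funpow_T_in by (auto simp: pull_def)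

lemma T_pull: "T -` pull j A \<inter> X = pull (Suc j) A"
  using T_X by (auto simp: pull_def funpow_swap1)

lemma preimage_clopen: "A \<in> clopens X \<Longrightarrow> T -` A \<inter> X \<in> clopens X"
  by (rule clopens_preimage[OF T_cont T_X])

lemma pull_clopen: "A \<in> clopens X \<Longrightarrow> pull j A \<in> clopens X"
proof (induction j)
  case 0
  moreover have "A \<inter> X = A" using 0 clopens_subset by blast
  ultimately show ?case by (simp add: pull_def)
next
  case (Suc j)
  then show ?case using preimage_clopen unfolding T_pull[symmetric] by blast
qed

lemma average_content:
  assumes q: "q \<in> contents X" and n: "0 < n"
  shows "average n q \<in> contents X"
proof -
  have "average n q A \<le> 1" for A
  proof -
    have "(\<Sum>j<n. q (pull j A)) \<le> (\<Sum>j<n. 1)"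
      by (intro sum_mono contents_le_1[OF q])
    then show ?thesis using n by (simp add: average_def)
  qed
  moreover have "0 \<le> average n q A" for A
    unfolding average_def by (intro divide_nonneg_nonneg sum_nonneg contents_nonneg[OF q]) auto
  moreover have "average n q X = 1"
  proof -
    have "pull j X = X" for j using funpow_T_in by (auto simp: pull_def)
    then show ?thesis using n contents_space[OF q] by (simp add: average_def)
  qed
  moreover have "average n q (A \<union> B) = average n q A + average n q B"
    if "A \<in> clopens X" "B \<in> clopens X" "A \<inter> B = {}" for A B
  proof -
    have "q (pull j (A \<union> B)) = q (pull j A) + q (pull j B)" for j
    proof -
      have "pull j (A \<union> B) = pull j A \<union> pull j B" by (auto simp: pull_def)
      moreover have "pull j A \<inter> pull j B = {}" using that(3) by (auto simp: pull_def)
      ultimately show ?thesis using contents_add[OF q] pull_clopen that(1,2) by simp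
    qed
    then show ?thesis by (simp add: average_def sum.distrib add_divide_distrib)
  qed
  ultimately show ?thesis unfolding contents_def by auto
qed

text \<open>The difference telescopes; only the terms of index \<open>0\<close> and \<open>n\<close>
  survive.\<close>

lemma average_almost_invariant:
  assumes q: "q \<in> contents X"
  shows "\<bar>average n q (T -` A \<inter> X) - average n q A\<bar> \<le> 1 / n"
proof -
  have "average n q (T -` A \<inter> X) - average n q A = (\<Sum>j<n. q (pull (Suc j) A) - q (pull j A)) / n"
    by (simp add: average_def pull_T sum_subtractf diff_divide_distrib)
  also have "\<dots> = (q (pull n A) - q (pull 0 A)) / n"
    by (simp only: sum_lessThan_telescope[of "\<lambda>j. q (pull j A)"])
  finally have eq: "\<bar>average n q (T -` A \<inter> X) - average n q A\<bar> = \<bar>q (pull n A) - q (pull 0 A)\<bar> / n"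
    by simp
  have "\<bar>q (pull n A) - q (pull 0 A)\<bar> \<le> 1"
    using contents_nonneg[OF q, of "pull n A"] contents_le_1[OF q, of "pull n A"]
      contents_nonneg[OF q, of "pull 0 A"] contents_le_1[OF q, of "pull 0 A"] by linarith
  then show ?thesis unfolding eq by (simp add: divide_right_mono)
qed

text \<open>Krylov-Bogoliubov with side conditions. Invariance up to \<open>1 / Suc N\<close>
  together with \<open>D N\<close> is a closed condition met by some average, and these conditions
  tighten with \<open>N\<close>; by compactness some content satisfies all of them and is therefore
  invariant. The sets \<open>D N\<close> carry the information that has to survive the
  limit.\<close>

lemma invariant_content_limit:
  assumes D: "\<And>N. closed (D N)" "decseq D"
    and ex: "\<And>N::nat. \<exists>n>N. \<exists>q\<in>contents X. average n q \<in> D N"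
  shows "\<exists>m\<in>invariant_contents. \<forall>N. m \<in> D N"
proof -
  define K where "K N = contents X \<inter> D N \<inter>
    (\<Inter>A\<in>clopens X. {q. \<bar>q (T -` A \<inter> X) - q A\<bar> \<le> 1 / real (Suc N)})" for N
  have "(\<Inter>N. K N) \<noteq> {}"
  proof (rule compact_Inter_decseq_nonempty)
    have cl: "closed (D N \<inter>
        (\<Inter>A\<in>clopens X. {q. \<bar>q (T -` A \<inter> X) - q A\<bar> \<le> 1 / real (Suc N)}))" for N
      by (intro closed_Int D closed_INT ballI closed_Collect_le continuous_on_rabs
          continuous_on_diff continuous_on_const continuous_on_product_coordinates)
    then show "compact (K 0)"
      unfolding K_def Int_assoc by (intro compact_Int_closed contents_compact)
    show "closed (K N)" for N
      unfolding K_def Int_assoc by (intro closed_Int[OF contents_closed cl])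
    show "K N \<noteq> {}" for N
    proof -
      obtain n q where nq: "n > N" "q \<in> contents X" "average n q \<in> D N" using ex by blast
      have "\<bar>average n q (T -` A \<inter> X) - average n q A\<bar> \<le> 1 / real (Suc N)" for A
      proof -
        have "1 / real n \<le> 1 / real (Suc N)" using nq(1) by (intro divide_left_mono) auto
        then show ?thesis using average_almost_invariant[OF nq(2), of n A] by linarith
      qed
      then have "average n q \<in> K N"
        using nq average_content[OF nq(2), of n] unfolding K_def by auto
      then show ?thesis by blast
    qed
    show "decseq K"
    proof (rule decseq_SucI, rule subsetI)
      fix N q assume q: "q \<in> K (Suc N)"
      have "1 / real (Suc (Suc N)) \<le> 1 / real (Suc N)" by (simp add: field_simps)
      then show "q \<in> K N" using q decseq_SucD[OF D(2), of N] unfolding K_def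
        by (auto intro: order_trans)
    qed
  qed
  then obtain m where m: "\<And>N. m \<in> K N" by blast
  have "m (T -` A \<inter> X) = m A" if "A \<in> clopens X" for A
  proof (rule ccontr)
    assume "m (T -` A \<inter> X) \<noteq> m A"
    then have "0 < \<bar>m (T -` A \<inter> X) - m A\<bar>" by simp
    from reals_Archimedean[OF this] obtain N where
      "inverse (real (Suc N)) < \<bar>m (T -` A \<inter> X) - m A\<bar>" by blast
    moreover have "\<bar>m (T -` A \<inter> X) - m A\<bar> \<le> 1 / real (Suc N)"
      using m[of N] that unfolding K_def by blast
    ultimately show False by (simp add: inverse_eq_divide)
  qed
  then show ?thesis using m unfolding K_def invariant_contents_def by blast
qed

lemma invariant_contents_compact: "compact invariant_contents"
  and invariant_contents_closed: "closed invariant_contents"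
proof -
  have eq: "invariant_contents = contents X \<inter> (\<Inter>A\<in>clopens X. {m. m (T -` A \<inter> X) = m A})"
    unfolding invariant_contents_def by auto
  have "closed (\<Inter>A\<in>clopens X. {m :: 'x set \<Rightarrow> real. m (T -` A \<inter> X) = m A})"
    by (intro closed_INT ballI closed_Collect_eq continuous_on_product_coordinates)
  then show "compact invariant_contents" "closed invariant_contents" unfolding eq
    by (intro compact_Int_closed closed_Int contents_compact contents_closed; assumption)+
qed

section \<open>Extremal invariant contents\<close>

lemma content_decseq_INF:
  assumes "m \<in> contents X" "decseq F" "\<And>N::nat. F N \<in> clopens X"
  shows "(\<lambda>N. m (F N)) \<longlonglongrightarrow> (INF N. m (F N))"
proof (rule LIMSEQ_decseq_INF)
  show "bdd_below (range (\<lambda>N. m (F N)))"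
    using contents_nonneg[OF assms(1)] by (intro bdd_belowI[of _ 0]) auto
  show "decseq (\<lambda>N. m (F N))"
    by (intro decseq_SucI contents_mono[OF assms(1)] assms(3) decseq_SucD[OF assms(2)])
qed

text \<open>This is the second summand when \<open>m\<close> is split with weight \<open>t\<close>
  on \<open>m'\<close>. Domination on a set gives nonnegativity, domination on its complement gives
  the upper bound 1. The value 0 off the clopen sets secures the bounds there, where domination is
  unknown.\<close>

lemma contents_remainder:
  assumes m: "m \<in> invariant_contents" and m': "m' \<in> invariant_contents"
    and t: "0 < t" "t < 1" and dom: "\<And>A. A \<in> clopens X \<Longrightarrow> t * m' A \<le> m A"
  shows "(\<lambda>A. if A \<in> clopens X then (m A - t * m' A) / (1 - t) else 0) \<in> invariant_contents"
    (is "?r \<in> _")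
proof -
  have c: "m \<in> contents X" "m' \<in> contents X" using m m' by (auto simp: invariant_contents_def)
  have "?r A \<le> 1" for A
  proof (cases "A \<in> clopens X")
    case True
    have "X - A \<in> clopens X" using True by (intro clopens_Diff) auto
    moreover have "A \<union> (X - A) = X" using clopens_subset[OF True] by blast
    ultimately have "m X = m A + m (X - A)" "m' X = m' A + m' (X - A)" "t * m' (X - A) \<le> m (X - A)"
      using contents_add[OF c(1) True, of "X - A"] contents_add[OF c(2) True, of "X - A"] dom by auto
    then have eq: "m A + m (X - A) = 1" "m' A + m' (X - A) = 1" and le: "t * m' (X - A) \<le> m (X - A)"
      unfolding contents_space[OF c(1)] contents_space[OF c(2)] by auto
    have "t * m' A + t * m' (X - A) = t"
      unfolding distrib_left[symmetric] eq(2) by simp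
    then have "m A - t * m' A \<le> 1 - t" using eq(1) le by linarith
    then show ?thesis using True t by simp
  qed simp
  moreover have "0 \<le> ?r A" for A using dom t by auto
  moreover have "?r X = 1" using t contents_space[OF c(1)] contents_space[OF c(2)] by simp
  moreover have "?r (A \<union> B) = ?r A + ?r B"
    if "A \<in> clopens X" "B \<in> clopens X" "A \<inter> B = {}" for A B
    using that clopens_Un[OF that(1,2)] contents_add[OF c(1) that] contents_add[OF c(2) that]
    by (simp add: add_divide_distrib[symmetric] algebra_simps)
  moreover have "?r (T -` A \<inter> X) = ?r A" if "A \<in> clopens X" for A
    using that preimage_clopen m m' by (simp add: invariant_contents_def)
  ultimately show ?thesis unfolding invariant_contents_def contents_def by blast
qed

text \<open>The function \<open>f 0\<close> is the infimum along \<open>F\<close>, and the later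
  \<open>f k\<close> evaluate at the enumerated clopen sets. Maximising \<open>f 0\<close> first
  preserves the lower bound \<open>s\<close>; the evaluations separate contents on clopen sets, so
  the lexicographic maximiser has no nontrivial splitting.\<close>

lemma extremal_content_exists:
  assumes m0: "m0 \<in> invariant_contents"
    and F: "decseq F" "\<And>N::nat. F N \<in> clopens X" "\<And>N. s \<le> m0 (F N)"
  obtains m where "extremal m" "\<And>N. s \<le> m (F N)"
proof -
  define f where
    "f k m = (case k of 0 \<Rightarrow> (INF N. m (F N)) | Suc k \<Rightarrow> m (from_nat_into (clopens X) k))"
    for k and m :: "'x set \<Rightarrow> real"
  have cont: "m \<in> contents X" if "m \<in> invariant_contents" for m
    using that by (simp add: invariant_contents_def)
  have bdd: "bdd_below (range (\<lambda>N. m (F N)))" if "m \<in> invariant_contents" for m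
    using contents_nonneg[OF cont[OF that]] by (intro bdd_belowI[of _ 0]) auto
  have f0: "s \<le> f 0 m \<longleftrightarrow> (\<forall>N. s \<le> m (F N))" if "m \<in> invariant_contents" for s m
    using bdd[OF that] by (simp add: f_def le_cINF_iff)
  have usc: "closed {m \<in> invariant_contents. s \<le> f k m}" for k s
  proof (cases k)
    case 0
    have "{m \<in> invariant_contents. s \<le> f k m} = invariant_contents \<inter> (\<Inter>N. {m. s \<le> m (F N)})"
      using f0 0 by blast
    then show ?thesis
      by (auto intro!: closed_Int invariant_contents_closed closed_INT closed_Collect_le
          continuous_on_const continuous_on_product_coordinates simp del: continuous_on_product_coordinates)
  next
    case (Suc k')
    have "{m \<in> invariant_contents. s \<le> f k m} =
        invariant_contents \<inter> {m. s \<le> m (from_nat_into (clopens X) k')}"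
      using Suc by (auto simp: f_def)
    then show ?thesis
      by (auto intro!: closed_Int invariant_contents_closed closed_Collect_le
          continuous_on_const continuous_on_product_coordinates)
  qed
  have ne: "invariant_contents \<noteq> {}" using m0 by blast
  obtain m where m: "m \<in> invariant_contents" "\<forall>q\<in>invariant_contents. f 0 q \<le> f 0 m"
    "\<forall>a\<in>invariant_contents. \<forall>b\<in>invariant_contents. \<forall>t. 0 < t \<longrightarrow> t < 1 \<longrightarrow>
       (\<forall>k. f k m = t * f k a + (1 - t) * f k b) \<longrightarrow> (\<forall>k. f k a = f k m)"
    using lexicographic_maximiser[where f = f, OF invariant_contents_compact
        invariant_contents_closed ne usc] by meson
  have "s \<le> f 0 m0" using f0[OF m0] F by simp
  then have s: "s \<le> m (F N)" for N using m(2) m0 f0[OF m(1), of s] by force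
  have "extremal m"
    unfolding extremal_def
  proof (intro conjI m(1) allI impI ballI)
    fix \<eta> :: real and m' A
    assume \<eta>: "0 < \<eta>" and m': "m' \<in> invariant_contents" and dom: "\<forall>A\<in>clopens X. \<eta> * m' A \<le> m A"
      and A: "A \<in> clopens X"
    \<comment> \<open>Capping the weight at \<open>1/2\<close> leaves the positive weight
      \<open>1 - t\<close> for the remainder, even if \<open>\<eta>\<close> is 1 or more.\<close>
    define t where "t = min \<eta> (1/2)"
    have t: "0 < t" "t < 1" "t \<le> \<eta>" using \<eta> by (auto simp: t_def)
    have dom': "t * m' A \<le> m A" if "A \<in> clopens X" for A
    proof -
      have "t * m' A \<le> \<eta> * m' A"
        using t(3) contents_nonneg[OF cont[OF m']] by (rule mult_right_mono)
      then show ?thesis using dom that by force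
    qed
    define r where "r = (\<lambda>A. if A \<in> clopens X then (m A - t * m' A) / (1 - t) else 0)"
    have r: "r \<in> invariant_contents"
      unfolding r_def by (rule contents_remainder[OF m(1) m' t(1,2) dom'])
    have split: "m A = t * m' A + (1 - t) * r A" if "A \<in> clopens X" for A
      using that t by (simp add: r_def)
    have "f k m = t * f k m' + (1 - t) * f k r" for k
    proof (cases k)
      case 0
      \<comment> \<open>Infima do not respect sums in general; along a decreasing sequence the
        infimum is a limit and hence affine in the content.\<close>
      have "(\<lambda>N. t * m' (F N) + (1 - t) * r (F N)) \<longlonglongrightarrow> t * f 0 m' + (1 - t) * f 0 r"
        using content_decseq_INF[OF cont[OF m'] F(1,2)] content_decseq_INF[OF cont[OF r] F(1,2)]
        unfolding f_def by (auto intro!: tendsto_intros)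
      moreover have "(\<lambda>N. t * m' (F N) + (1 - t) * r (F N)) = (\<lambda>N. m (F N))"
        using split F(2) by simp
      moreover have "(\<lambda>N. m (F N)) \<longlonglongrightarrow> f 0 m"
        using content_decseq_INF[OF cont[OF m(1)] F(1,2)] by (simp add: f_def)
      ultimately show ?thesis using 0 LIMSEQ_unique by metis
    next
      case (Suc k')
      have "from_nat_into (clopens X) k' \<in> clopens X"
        by (rule from_nat_into) (use clopens_simps in blast)
      then show ?thesis using split Suc by (simp add: f_def)
    qed
    then have eq: "f k m' = f k m" for k using m(3) m' r t(1,2) by blast
    obtain k where "from_nat_into (clopens X) k = A"
      using from_nat_into_surj[OF countable_clopens_X A] by blast
    then show "m' A = m A" using eq[of "Suc k"] by (simp add: f_def)
  qed
  then show thesis using s that by blast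
qed

end

section \<open>The measure of an extremal content\<close>

text \<open>Double counting: the sum of the probabilities is the integral over \<open>E\<close> of
  the number of \<open>j < n\<close> with \<open>x \<in> P j\<close>.\<close>

lemma (in prob_space)
  fixes n :: nat
  assumes E: "E \<in> events" and P: "\<And>j. j < n \<Longrightarrow> P j \<in> events"
  shows sum_prob_Int_ge:
      "(\<And>x. x \<in> E \<Longrightarrow> c \<le> real (card {j. j < n \<and> x \<in> P j})) \<Longrightarrow> c * prob E \<le> (\<Sum>j<n. prob (P j \<inter> E))"
    and sum_prob_Int_le:
      "(\<And>x. x \<in> E \<Longrightarrow> real (card {j. j < n \<and> x \<in> P j}) \<le> c) \<Longrightarrow> (\<Sum>j<n. prob (P j \<inter> E)) \<le> c * prob E"
proof -
  define g where "g x = (\<Sum>j<n. indicator (P j \<inter> E) x :: real)" for x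
  have g: "g x = real (card {j. j < n \<and> x \<in> P j}) * indicator E x" for x
  proof -
    have "g x = (\<Sum>j<n. if x \<in> P j then indicator E x else 0)"
      unfolding g_def by (intro sum.cong) (auto simp: indicator_def)
    also have "\<dots> = (\<Sum>j\<in>{j. j < n \<and> x \<in> P j}. indicator E x)"
      by (intro sum.mono_neutral_cong_right ballI) auto
    finally show ?thesis by simp
  qed
  have PE: "P j \<inter> E \<in> events" if "j < n" for j using P[OF that] E by auto
  have int: "integrable M g"
    unfolding g_def using PE
    by (intro Bochner_Integration.integrable_sum integrable_real_indicator) (auto simp: emeasure_eq_measure)
  have sum: "(\<integral>x. g x \<partial>M) = (\<Sum>j<n. prob (P j \<inter> E))"
    unfolding g_def using PE
    by (subst Bochner_Integration.integral_sum) (auto simp: emeasure_eq_measure)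
  have intE: "integrable M (\<lambda>x. c * indicator E x :: real)"
    using E by (intro integrable_mult_right integrable_real_indicator) (auto simp: emeasure_eq_measure)
  have cE: "(\<integral>x. c * indicator E x \<partial>M) = c * prob E" using E by simp
  show "c * prob E \<le> (\<Sum>j<n. prob (P j \<inter> E))"
    if "\<And>x. x \<in> E \<Longrightarrow> c \<le> real (card {j. j < n \<and> x \<in> P j})"
    unfolding sum[symmetric] cE[symmetric]
    by (intro integral_mono intE int) (use that in \<open>auto simp: g indicator_def\<close>)
  show "(\<Sum>j<n. prob (P j \<inter> E)) \<le> c * prob E"
    if "\<And>x. x \<in> E \<Longrightarrow> real (card {j. j < n \<and> x \<in> P j}) \<le> c"
    unfolding sum[symmetric] cE[symmetric]
    by (intro integral_mono intE int) (use that in \<open>auto simp: g indicator_def\<close>)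
qed

lemma Int_stable_clopens: "Int_stable (clopens X)"
  unfolding Int_stable_def using clopens_Int by blast

lemma finite_measures_eq_on_clopens:
  assumes "finite_measure M" "finite_measure N"
    and "sets M = sigma_sets X (clopens X)" "sets N = sigma_sets X (clopens X)"
    and eq: "\<And>A. A \<in> clopens X \<Longrightarrow> measure M A = measure N A"
  shows "M = N"
proof (rule measure_eqI_generator_eq[OF Int_stable_clopens, where A = "\<lambda>_::nat. X" and \<Omega> = X])
  interpret M: finite_measure M by fact
  interpret N: finite_measure N by fact
  show "emeasure M A = emeasure N A" if "A \<in> clopens X" for A
    using eq[OF that] by (simp add: M.emeasure_eq_measure N.emeasure_eq_measure)
  show "emeasure M X \<noteq> \<infinity>" by simp
  show "clopens X \<subseteq> Pow X" using clopens_subset by blast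
qed (use assms in auto)

locale extremal_measure = clopen_system +
  fixes m :: "'a set \<Rightarrow> real" and \<mu> :: "'a measure"
  assumes extr: "extremal m" and prob_\<mu>: "prob_space \<mu>"
    and sets_\<mu>: "sets \<mu> = sigma_sets X (clopens X)"
    and measure_\<mu>: "\<And>A. A \<in> clopens X \<Longrightarrow> measure \<mu> A = m A"
begin

sublocale prob_space \<mu> by (rule prob_\<mu>)

lemma space_\<mu>: "space \<mu> = X"
proof -
  have "clopens X \<subseteq> Pow X" using clopens_subset by blast
  then show ?thesis
    using sets_eq_imp_space_eq[of \<mu> "sigma X (clopens X)"] sets_\<mu> by simp
qed

lemma clopen_event: "A \<in> clopens X \<Longrightarrow> A \<in> events"
  unfolding sets_\<mu> by (rule sigma_sets.Basic)

lemma m_invariant: "A \<in> clopens X \<Longrightarrow> m (T -` A \<inter> X) = m A"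
  using extr unfolding extremal_def invariant_contents_def by auto

lemma m_pull: "A \<in> clopens X \<Longrightarrow> m (pull j A) = m A"
proof (induction j)
  case 0
  moreover have "A \<inter> X = A" using 0 clopens_subset by blast
  ultimately show ?case by (simp add: pull_def)
next
  case (Suc j)
  then show ?case using m_invariant[OF pull_clopen[of A j]] by (simp add: T_pull)
qed

section \<open>Invariance and ergodicity of the extended measure\<close>

lemma measurable_T: "T \<in> measurable \<mu> \<mu>"
proof (rule measurable_sigma_sets[OF sets_\<mu>])
  show "clopens X \<subseteq> Pow X" using clopens_subset by blast
  show "T \<in> space \<mu> \<rightarrow> X" using T_X space_\<mu> by auto
  show "T -` A \<inter> space \<mu> \<in> events" if "A \<in> clopens X" for A
    using clopen_event[OF preimage_clopen[OF that]] by (simp add: space_\<mu>)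
qed

lemma distr_T: "distr \<mu> \<mu> T = \<mu>"
proof (rule finite_measures_eq_on_clopens)
  show "finite_measure (distr \<mu> \<mu> T)" by (rule finite_measure_distr[OF measurable_T])
  show "measure (distr \<mu> \<mu> T) A = prob A" if "A \<in> clopens X" for A
    using that preimage_clopen[OF that] m_invariant[OF that] clopen_event
    by (simp add: measure_distr[OF measurable_T] space_\<mu> measure_\<mu>)
qed (auto simp: sets_\<mu> finite_measure_axioms)

lemma prob_preimage: "A \<in> events \<Longrightarrow> prob (T -` A \<inter> X) = prob A"
  using measure_distr[OF measurable_T, of A] by (simp add: distr_T space_\<mu>)

text \<open>Conditional probability given \<open>E\<close>, read as a set function on
  \<open>X\<close> so that it can be averaged as a content.\<close>

definition conditional :: "'a set \<Rightarrow> 'a set \<Rightarrow> real" where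
  "conditional E A = prob (A \<inter> E) / prob E"

lemma conditional_contents:
  assumes E: "E \<in> events" "0 < prob E"
  shows "conditional E \<in> contents X"
proof -
  have "prob (A \<inter> E) \<le> prob E" for A using E(1) by (intro finite_measure_mono) auto
  then have "0 \<le> conditional E A \<and> conditional E A \<le> 1" for A
    using E(2) by (simp add: conditional_def)
  moreover have "conditional E X = 1"
  proof -
    have "X \<inter> E = E" using sets.sets_into_space[OF E(1)] space_\<mu> by auto
    then show ?thesis using E(2) by (simp add: conditional_def)
  qed
  moreover have "conditional E (A \<union> B) = conditional E A + conditional E B"
    if "A \<in> clopens X" "B \<in> clopens X" "A \<inter> B = {}" for A B
  proof -
    have "prob ((A \<inter> E) \<union> (B \<inter> E)) = prob (A \<inter> E) + prob (B \<inter> E)"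
      using that E(1) clopen_event by (intro finite_measure_Union) auto
    then show ?thesis by (simp add: conditional_def Int_Un_distrib2 add_divide_distrib)
  qed
  ultimately show ?thesis unfolding contents_def by blast
qed

text \<open>For an invariant \<open>S\<close> of positive measure the conditional content is
  invariant, and \<open>prob S\<close> times it is dominated by \<open>m\<close>. Extremality makes
  it equal to \<open>m\<close>, so \<open>S\<close> is independent of every clopen set, hence of
  itself.\<close>

lemma ergodic:
  assumes S: "S \<in> events" "T -` S \<inter> X = S"
  shows "prob S = 0 \<or> prob S = 1"
proof (rule disjCI)
  assume "prob S \<noteq> 1"
  show "prob S = 0"
  proof (rule ccontr)
    assume "prob S \<noteq> 0"
    then have pos: "0 < prob S" by (simp add: zero_less_measure_iff)
    have "conditional S (T -` A \<inter> X) = conditional S A" if "A \<in> clopens X" for A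
    proof -
      have "T -` (A \<inter> S) \<inter> X = (T -` A \<inter> X) \<inter> S" using S(2) by auto
      then have "prob ((T -` A \<inter> X) \<inter> S) = prob (A \<inter> S)"
        using prob_preimage[of "A \<inter> S"] S(1) clopen_event[OF that] by auto
      then show ?thesis by (simp add: conditional_def)
    qed
    then have inv: "conditional S \<in> invariant_contents"
      using conditional_contents[OF S(1) pos] by (simp add: invariant_contents_def)
    have "prob S * conditional S A \<le> m A" if "A \<in> clopens X" for A
      using pos clopen_event[OF that] measure_\<mu>[OF that]
        finite_measure_mono[of "A \<inter> S" A] by (simp add: conditional_def)
    then have eq: "conditional S A = m A" if "A \<in> clopens X" for A
      using extr inv pos that unfolding extremal_def by blast
    \<comment> \<open>Independence of \<open>S\<close> from clopen sets is an equality of two finite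
      measures on a generator, so it extends to all events; evaluating at \<open>S\<close> gives
      that \<open>prob S\<close> equals its own square.\<close>
    have "density \<mu> (indicator S) = scale_measure (ennreal (prob S)) \<mu>"
    proof (rule finite_measures_eq_on_clopens)
      show "finite_measure (density \<mu> (indicator S))"
        using S(1) by (intro finite_measureI) (simp add: emeasure_density emeasure_eq_measure nn_integral_indicator)
      show "finite_measure (scale_measure (ennreal (prob S)) \<mu>)"
        by (intro finite_measureI) (simp add: emeasure_eq_measure ennreal_mult_eq_top_iff)
      fix A assume A: "A \<in> clopens X"
      show "measure (density \<mu> (indicator S)) A = measure (scale_measure (ennreal (prob S)) \<mu>) A"
        using eq[OF A] measure_\<mu>[OF A] pos S(1) clopen_event[OF A]
        by (simp add: conditional_def measure_def emeasure_density field_simps enn2real_mult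
            indicator_inter_arith[symmetric] nn_integral_indicator Int_commute)
    qed (auto simp: sets_\<mu>)
    then have "emeasure (density \<mu> (indicator S)) S = emeasure (scale_measure (ennreal (prob S)) \<mu>) S"
      by simp
    then have "emeasure \<mu> S = ennreal (prob S) * emeasure \<mu> S"
      using S(1) by (simp add: emeasure_density indicator_inter_arith[symmetric] nn_integral_indicator)
    then have "prob S = prob S * prob S"
      by (simp add: emeasure_eq_measure ennreal_mult[symmetric])
    then show False using pos \<open>prob S \<noteq> 1\<close> by simp
  qed
qed

section \<open>Visit rates to clopen sets\<close>

lemma pull_event: "C \<in> clopens X \<Longrightarrow> pull j C \<in> events"
  by (intro clopen_event pull_clopen)

lemma visit_rate_measurable:
  assumes C: "C \<in> clopens X"
  shows "visit_rate n C \<in> borel_measurable \<mu>"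
proof -
  have "visit_rate n C x = (\<Sum>j<n. indicator (pull j C) x) / n" if "x \<in> space \<mu>" for x
  proof -
    have "(\<Sum>j<n. indicator (pull j C) x :: real) = (\<Sum>j\<in>{j. j < n \<and> (T ^^ j) x \<in> C}. 1)"
      using that by (intro sum.mono_neutral_cong_right) (auto simp: pull_def space_\<mu>)
    then show ?thesis by (simp add: visit_rate_def)
  qed
  moreover have "(\<lambda>x. (\<Sum>j<n. indicator (pull j C) x) / real n) \<in> borel_measurable \<mu>"
    using pull_event[OF C] by measurable
  ultimately show ?thesis by (simp cong: measurable_cong)
qed

text \<open>The number \<open>average n (conditional E) C\<close> is the mean of
  \<open>visit_rate n C\<close> over \<open>E\<close>, so it inherits pointwise bounds valid on
  \<open>E\<close>.\<close>

lemma average_conditional_bounds: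
  assumes C: "C \<in> clopens X" and E: "E \<in> events" "0 < prob E" and n: "0 < n"
  shows "(\<And>x. x \<in> E \<Longrightarrow> c \<le> visit_rate n C x) \<Longrightarrow> c \<le> average n (conditional E) C"
    and "(\<And>x. x \<in> E \<Longrightarrow> visit_rate n C x \<le> c) \<Longrightarrow> average n (conditional E) C \<le> c"
proof -
  have avg: "average n (conditional E) C = (\<Sum>j<n. prob (pull j C \<inter> E)) / (n * prob E)"
    by (simp add: average_def conditional_def sum_divide_distrib[symmetric] mult.commute)
  have card: "real (card {j. j < n \<and> x \<in> pull j C}) = n * visit_rate n C x" if "x \<in> E" for x
  proof -
    have "x \<in> X" using sets.sets_into_space[OF E(1)] that space_\<mu> by auto
    then show ?thesis using n by (simp add: visit_rate_def pull_def)
  qed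
  have pos: "0 < n * prob E" using n E(2) by simp
  show "c \<le> average n (conditional E) C" if "\<And>x. x \<in> E \<Longrightarrow> c \<le> visit_rate n C x"
    using sum_prob_Int_ge[OF E(1) pull_event[OF C], where n = n and c = "real n * c"] that n pos
    by (simp add: card avg pos_le_divide_eq mult_ac)
  show "average n (conditional E) C \<le> c" if "\<And>x. x \<in> E \<Longrightarrow> visit_rate n C x \<le> c"
    using sum_prob_Int_le[OF E(1) pull_event[OF C], where n = n and c = "real n * c"] that n pos
    by (simp add: card avg pos_divide_le_eq mult_ac)
qed

text \<open>Invariance of \<open>m\<close> bounds the probability of each
  \<open>pull j A \<inter> E\<close> by \<open>m A\<close>. The constant \<open>\<eta>\<close> in
  place of \<open>prob E\<close> is uniform in \<open>E\<close> and \<open>n\<close>, so the bound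
  passes to limits.\<close>

lemma average_conditional_dominated:
  assumes A: "A \<in> clopens X" and E: "E \<in> events" and \<eta>: "0 < \<eta>" "\<eta> \<le> prob E" and n: "0 < n"
  shows "\<eta> * average n (conditional E) A \<le> m A"
proof -
  have "\<eta> * conditional E (pull j A) \<le> m A" for j
  proof -
    have "\<eta> * conditional E (pull j A) \<le> prob E * conditional E (pull j A)"
      using \<eta> by (intro mult_right_mono) (auto simp: conditional_def)
    also have "\<dots> = prob (pull j A \<inter> E)" using \<eta> by (simp add: conditional_def)
    also have "\<dots> \<le> prob (pull j A)" using pull_event[OF A] by (intro finite_measure_mono) auto
    also have "\<dots> = m A" using measure_\<mu>[OF pull_clopen[OF A]] m_pull[OF A] by simp
    finally show ?thesis .
  qed
  then have "(\<Sum>j<n. \<eta> * conditional E (pull j A)) \<le> (\<Sum>j<n. m A)" by (intro sum_mono)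
  then show ?thesis
    using n by (simp add: average_def sum_distrib_left[symmetric] pos_divide_le_eq mult_ac)
qed

text \<open>A set of positive measure on which the visit rate stays away from its mean would yield, by
  averaging the conditional contents, an invariant content dominated by a multiple of \<open>m\<close> but
  different from \<open>m\<close>.\<close>

lemma visit_rate_concentrates:
  assumes C: "C \<in> clopens X" and pos: "0 < \<delta>" "0 < \<eta>"
  shows "\<exists>n0. \<forall>n\<ge>n0. \<forall>E\<in>events. (\<forall>x\<in>E. \<delta> \<le> \<bar>visit_rate n C x - m C\<bar>) \<longrightarrow> prob E < \<eta>"
proof (rule ccontr)
  assume "\<not> ?thesis"
  then have bad: "\<exists>n\<ge>n0. \<exists>E\<in>events. (\<forall>x\<in>E. \<delta> \<le> \<bar>visit_rate n C x - m C\<bar>) \<and> \<eta> \<le> prob E" for n0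
    by (meson not_le)
  \<comment> \<open>The two closed conditions contradict each other for an invariant
    \<open>q\<close>: domination forces \<open>q C = m C\<close> by extremality, while the second
    keeps these values apart.\<close>
  define D where "D = (\<Inter>A\<in>clopens X. {q. \<eta> / 2 * q A \<le> m A}) \<inter> {q. \<delta> \<le> \<bar>q C - m C\<bar>}"
  have "\<exists>q\<in>invariant_contents. \<forall>N::nat. q \<in> D"
  proof (rule invariant_content_limit)
    show "closed D"
      unfolding D_def
      by (intro closed_Int closed_INT ballI closed_Collect_le continuous_on_rabs continuous_on_diff
          continuous_on_mult continuous_on_const continuous_on_product_coordinates)
    show "decseq (\<lambda>_::nat. D)" by (simp add: decseq_def)
    fix N :: nat
    obtain n E where n: "n \<ge> Suc N" and E: "E \<in> events" "\<And>x. x \<in> E \<Longrightarrow> \<delta> \<le> \<bar>visit_rate n C x - m C\<bar>"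
      "\<eta> \<le> prob E"
      using bad[of "Suc N"] by blast
    have EX: "E \<subseteq> X" using sets.sets_into_space[OF E(1)] space_\<mu> by auto
    \<comment> \<open>Deviations of opposite sign could cancel in the mean, so one sign is selected,
      at the cost of half the measure.\<close>
    define Ep where "Ep = E \<inter> {x \<in> space \<mu>. m C + \<delta> \<le> visit_rate n C x}"
    define En where "En = E \<inter> {x \<in> space \<mu>. visit_rate n C x \<le> m C - \<delta>}"
    have ev: "Ep \<in> events" "En \<in> events"
      using E(1) visit_rate_measurable[OF C, of n] unfolding Ep_def En_def by measurable
    have "x \<in> Ep \<union> En" if "x \<in> E" for x
    proof -
      have "x \<in> space \<mu>" using that EX space_\<mu> by auto
      then show ?thesis using E(2)[OF that] that
        unfolding Ep_def En_def by (cases "visit_rate n C x \<ge> m C") auto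
    qed
    then have "prob E \<le> prob (Ep \<union> En)" using ev by (intro finite_measure_mono) auto
    also have "\<dots> \<le> prob Ep + prob En" using ev by (rule measure_subadditive) auto
    finally have "\<eta> / 2 \<le> prob Ep \<or> \<eta> / 2 \<le> prob En" using E(3) by linarith
    then obtain E' where E': "E' = Ep \<or> E' = En" "\<eta> / 2 \<le> prob E'" by blast
    have E'_ev: "E' \<in> events" and E'_pos: "0 < prob E'" and n0: "0 < n"
      using E' ev pos(2) n by auto
    have "\<delta> \<le> \<bar>average n (conditional E') C - m C\<bar>"
      using E'(1)
    proof
      assume "E' = Ep"
      then have "m C + \<delta> \<le> average n (conditional E') C"
        by (intro average_conditional_bounds(1)[OF C E'_ev E'_pos n0]) (auto simp: Ep_def)
      then show ?thesis by linarith
    next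
      assume "E' = En"
      then have "average n (conditional E') C \<le> m C - \<delta>"
        by (intro average_conditional_bounds(2)[OF C E'_ev E'_pos n0]) (auto simp: En_def)
      then show ?thesis by linarith
    qed
    moreover have "\<eta> / 2 * average n (conditional E') A \<le> m A" if "A \<in> clopens X" for A
      using that E'_ev E'(2) pos(2) n0 by (intro average_conditional_dominated) auto
    ultimately have "average n (conditional E') \<in> D" unfolding D_def by blast
    then show "\<exists>n>N. \<exists>q\<in>contents X. average n q \<in> D"
      using conditional_contents[OF E'_ev E'_pos] n by (meson Suc_le_lessD)
  qed
  then obtain q where q: "q \<in> invariant_contents" "q \<in> D" by blast
  have "\<forall>A\<in>clopens X. \<eta> / 2 * q A \<le> m A" using q(2) unfolding D_def by blast
  then have "q C = m C" using extr q(1) pos(2) C unfolding extremal_def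
    by (meson half_gt_zero)
  then show False using q(2) pos(1) unfolding D_def by simp
qed

end

section \<open>Greedy decomposition of words\<close>

text \<open>A candidate has to fit into \<open>B\<close>, so positions near the right end may be
  uncovered for lack of room; the summand \<open>N\<close> in \<open>card_uncovered_window\<close>
  pays for them.\<close>

definition uncovered :: "'a list set \<Rightarrow> nat \<Rightarrow> 'a list \<Rightarrow> nat set" where
  "uncovered G N B =
     {i. i < length B \<and> (\<forall>k \<in> {1..N}. i + k \<le> length B \<longrightarrow> take k (drop i B) \<notin> G)}"

lemma finite_uncovered [simp]: "finite (uncovered G N B)"
  unfolding uncovered_def by simp

text \<open>Whether a position is uncovered depends only on the suffix that starts there.\<close>

lemma uncovered_drop:
  assumes "k \<le> length B"
  shows "(\<lambda>i. i + k) ` uncovered G N (drop k B) \<subseteq> uncovered G N B"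
  using assms by (auto simp: uncovered_def add.commute add.left_commute)

text \<open>Greedy parsing by induction on the length. A pair consists of a gap and the block of
  \<open>G\<close> after it, and \<open>z\<close> is the last gap. A letter is skipped only at an
  uncovered position, so the gaps together are no longer than the number of these positions.\<close>

lemma greedy_pairs:
  "\<exists>ps z. B = concat (map (\<lambda>(a, e). a @ e) ps) @ z \<and> (\<forall>p \<in> set ps. snd p \<in> G) \<and>
     length B \<le> sum_list (map (\<lambda>p. length (snd p)) ps) + card (uncovered G N B)"
proof (induction B rule: length_induct)
  case (1 B)
  have card_le: "card (uncovered G N (drop k B)) = card ((\<lambda>i. i + k) ` uncovered G N (drop k B))" for k
    by (rule card_image[symmetric]) (simp add: inj_on_def)
  consider k where "k \<in> {1..N}" "k \<le> length B" "take k B \<in> G"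
    | "B = []" | "B \<noteq> []" "\<forall>k \<in> {1..N}. k \<le> length B \<longrightarrow> take k B \<notin> G" by blast
  then show ?case
  proof cases
    case 1
    then have "length (drop k B) < length B" by auto
    then obtain ps z where IH: "drop k B = concat (map (\<lambda>(a, e). a @ e) ps) @ z"
      "\<forall>p \<in> set ps. snd p \<in> G"
      "length (drop k B) \<le> sum_list (map (\<lambda>p. length (snd p)) ps) + card (uncovered G N (drop k B))"
      using "1.IH" by blast
    have "card (uncovered G N (drop k B)) \<le> card (uncovered G N B)"
      unfolding card_le using uncovered_drop[OF 1(2)] by (intro card_mono) auto
    moreover have "B = concat (map (\<lambda>(a, e). a @ e) (([], take k B) # ps)) @ z"
      using IH(1) append_take_drop_id[of k B] by simp
    ultimately show ?thesis using IH(2,3) 1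
      by (intro exI[of _ "([], take k B) # ps"] exI[of _ z]) auto
  next
    case 2
    then show ?thesis by (intro exI[of _ "[]"]) simp
  next
    case 3
    then obtain a B' where B: "B = a # B'" by (cases B) auto
    then have "length B' < length B" by simp
    then obtain ps z where IH: "B' = concat (map (\<lambda>(a, e). a @ e) ps) @ z" "\<forall>p \<in> set ps. snd p \<in> G"
      "length B' \<le> sum_list (map (\<lambda>p. length (snd p)) ps) + card (uncovered G N B')"
      using "1.IH" by blast
    have drop1: "drop 1 B = B'" using B by simp
    have "0 \<in> uncovered G N B" using 3 by (simp add: uncovered_def)
    moreover have "(\<lambda>i. i + 1) ` uncovered G N B' \<subseteq> uncovered G N B"
      using uncovered_drop[of 1 B G N] B by (simp add: drop1)
    ultimately have "card (insert 0 ((\<lambda>i. i + 1) ` uncovered G N B')) \<le> card (uncovered G N B)"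
      by (intro card_mono) auto
    moreover have "card (insert 0 ((\<lambda>i. i + 1) ` uncovered G N B')) = Suc (card (uncovered G N B'))"
      by (subst card_insert_disjoint) (auto simp: card_image)
    ultimately have len: "length B \<le> sum_list (map (\<lambda>p. length (snd p)) ps) + card (uncovered G N B)"
      using IH(3) B by simp
    \<comment> \<open>The skipped letter is prepended to the next gap: that of the first pair, or
      the final gap if there is no pair.\<close>
    show ?thesis
    proof (cases ps)
      case Nil
      then show ?thesis using IH B len by (intro exI[of _ "[]"] exI[of _ "a # z"]) auto
    next
      case (Cons p qs)
      obtain b e where "p = (b, e)" by fastforce
      then show ?thesis using Cons IH B len
        by (intro exI[of _ "(a # b, e) # qs"] exI[of _ z]) auto
    qed
  qed
qed

lemma greedy_decomposition:
  "\<exists>r A E. B = concat (map (\<lambda>j. A j @ E j) [1..<Suc r]) @ A (Suc r) \<and>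
     (\<forall>j \<in> {1..r}. E j \<in> G) \<and> length B \<le> (\<Sum>j = 1..r. length (E j)) + card (uncovered G N B)"
proof -
  obtain ps z where ps: "B = concat (map (\<lambda>(a, e). a @ e) ps) @ z" "\<forall>p \<in> set ps. snd p \<in> G"
     "length B \<le> sum_list (map (\<lambda>p. length (snd p)) ps) + card (uncovered G N B)"
    using greedy_pairs[of B G N] by auto
  \<comment> \<open>The families are indexed from 1 and the list from 0; the index after the last
    pair returns the trailing gap.\<close>
  define A where "A j = (if j \<le> length ps then fst (ps ! (j - 1)) else z)" for j
  define E where "E j = snd (ps ! (j - 1))" for j
  have "map (\<lambda>j. A j @ E j) [1..<Suc (length ps)] = map (\<lambda>(a, e). a @ e) ps"
    by (rule nth_equalityI) (auto simp: A_def E_def case_prod_beta simp del: upt_Suc)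
  then have "B = concat (map (\<lambda>j. A j @ E j) [1..<Suc (length ps)]) @ A (Suc (length ps))"
    using ps(1) by (simp add: A_def del: upt_Suc)
  moreover have "(\<Sum>j = 1..length ps. length (E j)) = sum_list (map (\<lambda>p. length (snd p)) ps)"
    by (simp add: sum_list_sum_nth sum.atLeast1_atMost_eq E_def lessThan_atLeast0)
  moreover have "\<forall>j \<in> {1..length ps}. E j \<in> G" using ps(2) by (auto simp: E_def)
  ultimately show ?thesis using ps(3) by (intro exI[of _ "length ps"] exI[of _ A] exI[of _ E]) simp
qed

section \<open>Words and frequencies\<close>

lemma shift_map_funpow: "(shift_map ^^ j) x = (\<lambda>i. x (i + of_nat j))"
  by (induction j) (auto simp: shift_map_def add_ac)

lemma length_window [simp]: "length (window x i k) = k"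
  by (simp add: window_def)

lemma take_drop_window:
  "i + k \<le> n \<Longrightarrow> take k (drop i (window x 0 n)) = window ((shift_map ^^ i) x) 0 k"
  by (rule nth_equalityI) (auto simp: window_def shift_map_funpow add_ac)

lemma continuous_shift_map: "continuous_on S (shift_map :: ('i::semiring_1 \<Rightarrow> 'a::topological_space) \<Rightarrow> _)"
  unfolding shift_map_def
  by (intro continuous_on_coordinatewise_then_product
      continuous_on_subset[OF continuous_on_product_coordinates]) auto

lemma finite_words: "finite {C :: 'a::finite list. length C = l}"
  using finite_lists_length_eq[of "UNIV :: 'a set" l] by simp

lemma window_set_clopen:
  fixes X :: "('i::semiring_1 \<Rightarrow> 'a::{finite,discrete_topology}) set"
  shows "{x \<in> X. window x 0 n \<in> S} \<in> clopens X"
proof -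
  have "{x \<in> X. window x 0 n = C} \<in> clopens X" if "length C = n" for C
  proof -
    have "{x \<in> X. window x 0 n = C} = X \<inter> coordinate_box ((\<lambda>j. (of_nat j, C ! j)) ` {..<n})"
      using that by (auto simp: coordinate_box_def window_def list_eq_iff_nth_eq)
    then show ?thesis by (simp add: clopens_restrict coordinate_box_clopen)
  qed
  then have "(\<Union>C \<in> {C \<in> S. length C = n}. {x \<in> X. window x 0 n = C}) \<in> clopens X"
    by (intro clopens_UN) (auto intro: finite_subset[OF _ finite_words])
  moreover have "{x \<in> X. window x 0 n \<in> S} = (\<Union>C \<in> {C \<in> S. length C = n}. {x \<in> X. window x 0 n = C})"
    by auto
  ultimately show ?thesis by simp
qed

lemma cylinder_clopen:
  fixes X :: "('i::semiring_1 \<Rightarrow> 'a::{finite,discrete_topology}) set"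
  shows "cylinder X C \<in> clopens X"
  using window_set_clopen[of X "length C" "{C}"] by (simp add: cylinder_def)

section \<open>Frequencies of words and the distance \<open>d_star\<close>\<close>

lemma block_freq_nonneg: "0 \<le> block_freq B C"
  by (simp add: block_freq_def)

text \<open>Different words occupy disjoint sets of positions, and there are
  \<open>length B - l + 1\<close> positions, which is at most \<open>length B\<close> because
  \<open>l\<close> is positive.\<close>

lemma sum_block_freq_le_1:
  fixes B :: "'a::finite list"
  assumes "0 < l"
  shows "(\<Sum>C | length C = l. block_freq B C) \<le> 1"
proof (cases "l \<le> length B")
  case True
  let ?I = "\<lambda>C. {i \<in> {0..length B - l}. take l (drop i B) = C}"
  have "(\<Sum>C | length C = l. card (?I C)) = card (\<Union>C \<in> {C. length C = l}. ?I C)"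
    by (rule card_UN_disjoint[symmetric]) (auto intro: finite_words)
  also have "\<dots> \<le> card {0..length B - l}" by (intro card_mono) auto
  also have "\<dots> \<le> length B" using assms True by simp
  finally have "real (\<Sum>C | length C = l. card (?I C)) \<le> real (length B)" by (simp only: of_nat_le_iff)
  moreover have "(\<Sum>C | length C = l. block_freq B C) = real (\<Sum>C | length C = l. card (?I C)) / length B"
    using True by (simp add: block_freq_def sum_divide_distrib)
  ultimately show ?thesis using assms True by (simp add: divide_le_eq)
qed (simp add: block_freq_def)

text \<open>Only finitely many words have to be controlled: since the inner sums are at most 2, the
  terms with \<open>l \<ge> L\<close> add up to at most \<open>2 * (1/2) ^ L\<close>, which is below
  \<open>\<delta> / 2\<close>.\<close>

lemma d_star_less:
  fixes X :: "('i::semiring_1 \<Rightarrow> 'a::finite) set"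
  assumes \<delta>: "0 < \<delta>"
  shows "\<exists>W \<gamma>. finite W \<and> [] \<notin> W \<and> 0 < \<gamma> \<and>
    (\<forall>p q. (\<forall>l. (\<Sum>C | length C = Suc l. \<bar>value_on X p C - value_on X q C\<bar>) \<le> 2) \<longrightarrow>
       (\<forall>C\<in>W. \<bar>value_on X p C - value_on X q C\<bar> < \<gamma>) \<longrightarrow> d_star X p q < \<delta>)"
proof -
  obtain L where L: "(1/2::real) ^ L < \<delta> / 4"
    using real_arch_pow_inv[of "\<delta> / 4" "1/2"] \<delta> by auto
  define W where "W = (\<Union>l<L. {C :: 'a list. length C = Suc l})"
  \<comment> \<open>With this choice the first \<open>L\<close> terms contribute at most
    \<open>\<delta> / 2\<close>; the summand 1 keeps the divisor positive when \<open>W\<close> is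
    empty.\<close>
  define K where "K = 1 + real (card W)"
  define \<gamma> where "\<gamma> = \<delta> / (2 * K)"
  have finW: "finite W" unfolding W_def by (auto intro: finite_words)
  have K: "0 < K" by (simp add: K_def add_pos_nonneg)
  have \<gamma>: "0 < \<gamma>" "K * \<gamma> = \<delta> / 2" using \<delta> K by (auto simp: \<gamma>_def)
  show ?thesis
  proof (intro exI[of _ W] exI[of _ \<gamma>] conjI allI impI)
    show "finite W" by fact
    show "[] \<notin> W" by (auto simp: W_def)
    show "0 < \<gamma>" by fact
    fix p q :: "'a list + ('i \<Rightarrow> 'a) measure"
    define t where "t l = (\<Sum>C | length C = Suc l. \<bar>value_on X p C - value_on X q C\<bar>)" for l
    assume t2: "\<forall>l. (\<Sum>C | length C = Suc l. \<bar>value_on X p C - value_on X q C\<bar>) \<le> 2"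
      and close: "\<forall>C\<in>W. \<bar>value_on X p C - value_on X q C\<bar> < \<gamma>"
    have t0: "0 \<le> t l" for l unfolding t_def by (intro sum_nonneg) auto
    have tl: "t l \<le> K * \<gamma>" if "l < L" for l
    proof -
      have sub: "{C :: 'a list. length C = Suc l} \<subseteq> W" using that by (auto simp: W_def)
      have "t l \<le> (\<Sum>C | length (C :: 'a list) = Suc l. \<gamma>)"
        unfolding t_def by (rule sum_mono) (use close sub in \<open>auto intro: less_imp_le\<close>)
      also have "\<dots> \<le> real (card W) * \<gamma>"
        using card_mono[OF finW sub] \<gamma>(1) by simp
      also have "\<dots> \<le> K * \<gamma>" using \<gamma>(1) by (simp add: K_def distrib_right)
      finally show ?thesis .
    qed
    have geo: "(\<lambda>l. (1/2::real) ^ Suc l) sums 1" by (rule power_half_series)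
    define u where "u l = (1/2) ^ Suc l * (if l < L then K * \<gamma> else 2)" for l :: nat
    have le: "(1/2) ^ Suc l * t l \<le> u l" for l
      using tl t2[rule_format, of l] unfolding u_def t_def by (intro mult_left_mono) auto
    have us: "u sums (K * \<gamma> * (\<Sum>l<L. (1/2) ^ Suc l) + 2 * (1/2) ^ L)"
    proof -
      have "(\<lambda>l. u (l + L)) = (\<lambda>l. 2 * (1/2) ^ L * (1/2) ^ Suc l)"
        by (simp add: u_def power_add mult_ac)
      then have "(\<lambda>l. u (l + L)) sums (2 * (1/2) ^ L * 1)"
        using sums_mult[OF geo, of "2 * (1/2) ^ L"] by simp
      then have "u sums (2 * (1/2) ^ L * 1 + (\<Sum>l<L. u l))"
        by (subst sums_iff_shift'[symmetric]) (simp add: sums_iff_shift)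
      moreover have "(\<Sum>l<L. u l) = K * \<gamma> * (\<Sum>l<L. (1/2) ^ Suc l)"
        by (simp add: u_def sum_distrib_left mult_ac)
      ultimately show ?thesis by (simp add: add.commute)
    qed
    have "(\<Sum>l<L. (1/2::real) ^ Suc l) \<le> 1"
      using sum_le_suminf[of "\<lambda>l. (1/2::real) ^ Suc l" "{..<L}"] geo by (simp add: sums_iff)
    then have lt: "K * \<gamma> * (\<Sum>l<L. (1/2) ^ Suc l) + 2 * (1/2) ^ L < \<delta>"
    proof -
      have "K * \<gamma> * (\<Sum>l<L. (1/2) ^ Suc l) \<le> K * \<gamma> * 1"
        using \<open>(\<Sum>l<L. (1/2::real) ^ Suc l) \<le> 1\<close> \<gamma>(2) \<delta> by (intro mult_left_mono) auto
      then show ?thesis using L \<gamma>(2) by linarith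
    qed
    have "summable (\<lambda>l. (1/2) ^ Suc l * t l)"
      by (rule summable_comparison_test'[OF sums_summable[OF us], of 0]) (use le t0 in auto)
    then have "d_star X p q \<le> suminf u"
      unfolding d_star_def t_def[symmetric] using le sums_summable[OF us] by (intro suminf_le) auto
    then show "d_star X p q < \<delta>" using lt us by (simp add: sums_iff)
  qed
qed

section \<open>Decomposition of long blocks\<close>

text \<open>The conclusion of the theorem for a single block, with \<open>G\<close> in the place of
  the blocks in \<open>U\<close>.\<close>

definition decomposable :: "'a list set \<Rightarrow> real \<Rightarrow> 'a list \<Rightarrow> bool" where
  "decomposable G \<epsilon> B \<longleftrightarrow> (\<exists>(r::nat) (A :: nat \<Rightarrow> 'a list) (E :: nat \<Rightarrow> 'a list).
     B = concat (map (\<lambda>j. A j @ E j) [1..<Suc r]) @ A (Suc r) \<and> (\<forall>j \<in> {1..r}. E j \<in> G) \<and>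
     real (\<Sum>j = 1..r. length (E j)) \<ge> (1 - \<epsilon>) * real (length B))"

text \<open>Otherwise the greedy decomposition with length bound \<open>N\<close> would witness
  decomposability; this holds for every \<open>N\<close> at once.\<close>

lemma undecomposable_uncovered:
  assumes "\<not> decomposable G \<epsilon> B"
  shows "\<epsilon> * length B < card (uncovered G N B)"
proof (rule ccontr)
  assume *: "\<not> ?thesis"
  obtain r A E where d: "B = concat (map (\<lambda>j. A j @ E j) [1..<Suc r]) @ A (Suc r)"
    "\<forall>j \<in> {1..r}. E j \<in> G" "length B \<le> (\<Sum>j = 1..r. length (E j)) + card (uncovered G N B)"
    using greedy_decomposition[of B G N] by blast
  have "real (length B) \<le> real (\<Sum>j = 1..r. length (E j)) + real (card (uncovered G N B))"
    using d(3) by linarith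
  then have "real (\<Sum>j = 1..r. length (E j)) \<ge> (1 - \<epsilon>) * real (length B)"
    using * by (simp add: algebra_simps)
  then show False using assms d(1,2) unfolding decomposable_def by blast
qed

text \<open>The common ground of one-sided and two-sided subshifts: \<open>block_start\<close> lets
  every block be read off at coordinate 0, so that the forward orbit suffices.\<close>

locale configuration_system =
  fixes X :: "('i::{semiring_1,countable} \<Rightarrow> 'a::{finite,discrete_topology}) set"
  assumes X_closed: "closed X" and shift_X: "shift_map ` X \<subseteq> X"
    and block_start: "\<And>B. B \<in> blocks X \<Longrightarrow> \<exists>y\<in>X. B = window y 0 (length B)"
begin

lemma X_compact: "compact X"
  using compact_Int_closed[OF compact_UNIV_configurations X_closed] by simp

sublocale clopen_system X shift_map
  by unfold_locales
    (use X_compact X_closed countable_clopens shift_X continuous_shift_map in auto)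

text \<open>The counterpart of \<open>uncovered\<close> for points of \<open>X\<close>. Only initial
  words of length at most \<open>N\<close> are inspected, which makes the set clopen.\<close>

definition unvisited :: "'a list set \<Rightarrow> nat \<Rightarrow> ('i \<Rightarrow> 'a) set" where
  "unvisited G N = {x \<in> X. \<forall>k \<in> {1..N}. window x 0 k \<notin> G}"

lemma unvisited_clopen: "unvisited G N \<in> clopens X"
proof -
  have "unvisited G N = X - (\<Union>k\<in>{1..N}. {x \<in> X. window x 0 k \<in> G})"
    by (auto simp: unvisited_def)
  moreover have "(\<Union>k\<in>{1..N}. {x \<in> X. window x 0 k \<in> G}) \<in> clopens X"
    by (intro clopens_UN window_set_clopen) simp
  ultimately show ?thesis by (simp add: clopens_Diff)
qed

lemma unvisited_decseq: "decseq (unvisited G)"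
  by (auto simp: decseq_def unvisited_def)

text \<open>At a position \<open>i\<close> with \<open>i + N \<le> n\<close> all candidates fit into
  the window, so being uncovered is a visit to \<open>unvisited G N\<close>; at most
  \<open>N\<close> positions remain.\<close>

lemma card_uncovered_window:
  assumes "y \<in> X"
  shows "card (uncovered G N (window y 0 n)) \<le>
    card {j. j < n \<and> (shift_map ^^ j) y \<in> unvisited G N} + N"
proof -
  have "uncovered G N (window y 0 n) \<subseteq>
      {j. j < n \<and> (shift_map ^^ j) y \<in> unvisited G N} \<union> {n - N..<n}"
  proof
    fix i assume i: "i \<in> uncovered G N (window y 0 n)"
    then have "i < n" by (simp add: uncovered_def)
    show "i \<in> {j. j < n \<and> (shift_map ^^ j) y \<in> unvisited G N} \<union> {n - N..<n}"
    proof (cases "i + N \<le> n")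
      case True
      have "window ((shift_map ^^ i) y) 0 k \<notin> G" if "k \<in> {1..N}" for k
      proof -
        have "i + k \<le> n" using True that by auto
        then show ?thesis using i that take_drop_window[of i k n y] by (auto simp: uncovered_def)
      qed
      then show ?thesis using \<open>i < n\<close> funpow_T_in[OF assms] by (simp add: unvisited_def)
    qed (use \<open>i < n\<close> in auto)
  qed
  then have "card (uncovered G N (window y 0 n)) \<le>
      card ({j. j < n \<and> (shift_map ^^ j) y \<in> unvisited G N} \<union> {n - N..<n})"
    by (rule card_mono[rotated]) simp
  also have "\<dots> \<le> card {j. j < n \<and> (shift_map ^^ j) y \<in> unvisited G N} + card {n - N..<n}"
    by (rule card_Un_le)
  finally show ?thesis by simp
qed

text \<open>The Dirac content at \<open>y\<close>; its averages are the empirical distributions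
  along the orbit of \<open>y\<close>.\<close>

lemma indicator_content: "y \<in> X \<Longrightarrow> (\<lambda>A. indicator A y) \<in> contents X"
  by (auto simp: contents_def indicator_def)

lemma average_indicator: "y \<in> X \<Longrightarrow> average n (\<lambda>A. indicator A y) A = visit_rate n A y"
proof -
  assume "y \<in> X"
  then have "(\<Sum>j<n. indicator (pull j A) y :: real) = (\<Sum>j\<in>{j. j < n \<and> (shift_map ^^ j) y \<in> A}. 1)"
    by (intro sum.mono_neutral_cong_right) (auto simp: pull_def)
  then show ?thesis by (simp add: average_def visit_rate_def)
qed

text \<open>The contents averaged are Dirac contents at points whose initial window is an
  undecomposable block. More than \<open>\<epsilon> * n\<close> positions are uncovered and the end
  of the block accounts for at most half of that, which leaves the rate
  \<open>\<epsilon> / 2\<close>.\<close>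

lemma undecomposable_limit:
  assumes \<epsilon>: "0 < \<epsilon>"
    and undec: "\<And>n0. \<exists>B\<in>blocks X. n0 \<le> length B \<and> \<not> decomposable G \<epsilon> B"
  shows "\<exists>m\<in>invariant_contents. \<forall>N. \<epsilon> / 2 \<le> m (unvisited G N)"
proof -
  define D where "D N = (\<Inter>M\<in>{..N}. {q. \<epsilon> / 2 \<le> q (unvisited G M)})" for N
  have "\<exists>m\<in>invariant_contents. \<forall>N. m \<in> D N"
  proof (rule invariant_content_limit)
    show "closed (D N)" for N
      unfolding D_def
      by (intro closed_INT ballI closed_Collect_le continuous_on_const continuous_on_product_coordinates)
    show "decseq D" by (auto simp: decseq_def D_def)
    fix N :: nat
    \<comment> \<open>This length makes the end loss \<open>N\<close> at most
      \<open>\<epsilon> * n / 2\<close>.\<close>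
    obtain n0 :: nat where n0: "2 * real N / \<epsilon> \<le> n0" using real_arch_simple by blast
    obtain B where B: "B \<in> blocks X" "max n0 (Suc N) \<le> length B" "\<not> decomposable G \<epsilon> B"
      using undec by blast
    define n where "n = length B"
    obtain y where y: "y \<in> X" "B = window y 0 n" using block_start[OF B(1)] n_def by blast
    have n: "0 < n" "N < n" "2 * real N \<le> \<epsilon> * n"
    proof -
      show "0 < n" "N < n" using B(2) by (auto simp: n_def)
      have "2 * real N \<le> \<epsilon> * n0" using n0 \<epsilon> by (simp add: pos_divide_le_eq mult.commute)
      also have "\<dots> \<le> \<epsilon> * n" using B(2) \<epsilon> by (simp add: n_def)
      finally show "2 * real N \<le> \<epsilon> * n" .
    qed
    have "\<epsilon> / 2 \<le> average n (\<lambda>A. indicator A y) (unvisited G M)" if "M \<le> N" for M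
    proof -
      have "\<epsilon> * n < card (uncovered G M B)"
        using undecomposable_uncovered[OF B(3)] by (simp add: n_def)
      also have "\<dots> \<le> card {j. j < n \<and> (shift_map ^^ j) y \<in> unvisited G M} + real M"
        using card_uncovered_window[OF y(1), of G M n] y(2) by (simp flip: of_nat_add)
      finally have "\<epsilon> / 2 * n \<le> card {j. j < n \<and> (shift_map ^^ j) y \<in> unvisited G M}"
        using n(3) that by linarith
      then show ?thesis
        using n(1) by (simp add: average_indicator[OF y(1)] visit_rate_def pos_le_divide_eq)
    qed
    then have "average n (\<lambda>A. indicator A y) \<in> D N" by (simp add: D_def)
    then show "\<exists>n>N. \<exists>q\<in>contents X. average n q \<in> D N"
      using n(2) indicator_content[OF y(1)] by blast
  qed
  then show ?thesis by (auto simp: D_def)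
qed

text \<open>Visits at times up to \<open>n - length C\<close> are exactly the occurrences of
  \<open>C\<close> in the window; fewer than \<open>length C\<close> later visits overhang its end.
  If \<open>C\<close> is longer than the window, the frequency is 0 and the bound exceeds 1.\<close>

lemma visit_rate_cylinder_close:
  assumes x: "x \<in> X" and C: "C \<noteq> []" and n: "0 < n"
  shows "\<bar>visit_rate n (cylinder X C) x - block_freq (window x 0 n) C\<bar> \<le> length C / n"
proof -
  define V where "V = {j. j < n \<and> (shift_map ^^ j) x \<in> cylinder X C}"
  have vis: "visit_rate n (cylinder X C) x = card V / n" by (simp add: visit_rate_def V_def)
  have fin: "finite V" by (simp add: V_def)
  show ?thesis
  proof (cases "length C \<le> n")
    case True
    define I where "I = {i \<in> {0..n - length C}. take (length C) (drop i (window x 0 n)) = C}"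
    have freq: "block_freq (window x 0 n) C = card I / n"
      using True by (simp add: block_freq_def I_def)
    have mem: "i \<in> V \<longleftrightarrow> i \<in> I" if "i \<le> n - length C" for i
    proof -
      have "i + length C \<le> n" "i < n" using that True C by (auto simp flip: length_greater_0_conv)
      then show ?thesis using that take_drop_window[of i "length C" n x] funpow_T_in[OF x]
        by (auto simp: V_def I_def cylinder_def)
    qed
    have "I \<subseteq> V" using mem by (auto simp: I_def)
    moreover have "V \<subseteq> I \<union> {n - length C<..<n}"
    proof
      fix j assume "j \<in> V"
      then show "j \<in> I \<union> {n - length C<..<n}"
        using mem[of j] by (cases "j \<le> n - length C") (auto simp: V_def)
    qed
    ultimately have "card I \<le> card V" "card V \<le> card (I \<union> {n - length C<..<n})"
      using fin by (auto intro!: card_mono simp: I_def)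
    moreover have "card (I \<union> {n - length C<..<n}) \<le> card I + length C"
      using card_Un_le[of I "{n - length C<..<n}"] by simp
    ultimately have "\<bar>real (card V) - real (card I)\<bar> \<le> length C" by linarith
    then show ?thesis
      using n by (simp add: vis freq diff_divide_distrib[symmetric] divide_right_mono)
  next
    case False
    have "card V \<le> card {..<n}" by (rule card_mono) (auto simp: V_def)
    then have "real (card V) \<le> length C" using False by simp
    then show ?thesis using False n by (simp add: vis block_freq_def divide_right_mono)
  qed
qed

text \<open>If \<open>s\<close> were positive, an extremal content with the same lower bounds would
  extend to an ergodic measure \<open>\<mu>\<close>, which lies in the open set \<open>U\<close>.
  For large \<open>n\<close>, outside a set of measure less than \<open>s\<close>, the window of
  length \<open>n\<close> is so close to \<open>\<mu>\<close> that it belongs to \<open>U\<close>,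
  which excludes the point from \<open>unvisited\<close>.\<close>

lemma unvisited_not_charged:
  assumes U: "d_star_open X U" "Inr ` ergodic_measures X \<subseteq> U"
    and m0: "m0 \<in> invariant_contents" "\<And>N. s \<le> m0 (unvisited {B. Inl B \<in> U} N)"
  shows "s \<le> 0"
proof (rule ccontr)
  assume "\<not> s \<le> 0"
  then have s: "0 < s" by simp
  let ?F = "unvisited {B. Inl B \<in> U}"
  obtain m where m: "extremal m" "\<And>N. s \<le> m (?F N)"
    using extremal_content_exists[OF m0(1) unvisited_decseq unvisited_clopen m0(2)] by blast
  have mc: "m \<in> contents X" using m(1) by (simp add: extremal_def invariant_contents_def)
  obtain \<mu> where \<mu>: "prob_space \<mu>" "space \<mu> = X" "sets \<mu> = sigma_sets X (clopens X)"
    "\<And>A. A \<in> clopens X \<Longrightarrow> measure \<mu> A = m A"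
    using content_extends_to_measure[OF X_compact X_closed mc] by blast
  interpret \<mu>: extremal_measure X shift_map m \<mu>
    by (intro extremal_measure.intro extremal_measure_axioms.intro clopen_system_axioms m(1) \<mu>)
  have "\<mu> \<in> ergodic_measures X"
    using \<mu>.prob_preimage \<mu>.ergodic \<mu>(1,3) sigma_sets_clopens[OF X_closed]
    by (auto simp: ergodic_measures_def invariant_measures_def borel_prob_measures_def)
  then have "Inr \<mu> \<in> U" using U(2) by blast
  then obtain \<delta> where \<delta>: "0 < \<delta>"
    "\<And>q. q \<in> blocks_and_measures X \<Longrightarrow> d_star X (Inr \<mu>) q < \<delta> \<Longrightarrow> q \<in> U"
    using U(1) unfolding d_star_open_def by meson
  obtain W \<gamma> where W: "finite W" "[] \<notin> W" "0 < \<gamma>" and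
    close: "\<And>p q. \<forall>l. (\<Sum>C | length C = Suc l. \<bar>value_on X p C - value_on X q C\<bar>) \<le> 2 \<Longrightarrow>
       \<forall>C\<in>W. \<bar>value_on X p C - value_on X q C\<bar> < \<gamma> \<Longrightarrow> d_star X p q < \<delta>"
    using d_star_less[OF \<delta>(1), of X] by blast
  \<comment> \<open>Over words of a fixed positive length the values of a measure and of a block
    each sum to at most 1; this is the side condition of \<open>d_star_less\<close>.\<close>
  have sum_le_2: "(\<Sum>C | length C = Suc l.
      \<bar>value_on X (Inr \<mu>) C - value_on X (Inl B) C\<bar>) \<le> 2" for l and B :: "'a list"
  proof -
    have "(\<Sum>C | length C = Suc l. \<bar>value_on X (Inr \<mu>) C - value_on X (Inl B) C\<bar>) \<le>
        (\<Sum>C | length C = Suc l. measure \<mu> (cylinder X C) + block_freq B C)"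
    proof (rule sum_mono)
      fix C :: "'a list"
      show "\<bar>value_on X (Inr \<mu>) C - value_on X (Inl B) C\<bar> \<le> measure \<mu> (cylinder X C) + block_freq B C"
        using measure_nonneg[of \<mu> "cylinder X C"] block_freq_nonneg[of B C]
        by (simp add: value_on_def abs_le_iff)
    qed
    also have "\<dots> = (\<Sum>C | length C = Suc l. measure \<mu> (cylinder X C)) +
        (\<Sum>C | length C = Suc l. block_freq B C)"
      by (rule sum.distrib)
    also have "(\<Sum>C | length C = Suc l. measure \<mu> (cylinder X C)) =
        measure \<mu> (\<Union>C\<in>{C. length C = Suc l}. cylinder X C)"
    proof (rule \<mu>.finite_measure_finite_Union[symmetric])
      show "disjoint_family_on (cylinder X) {C. length C = Suc l}"
        by (auto simp: disjoint_family_on_def cylinder_def)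
      show "cylinder X ` {C. length C = Suc l} \<subseteq> sets \<mu>"
        using \<mu>.clopen_event[OF cylinder_clopen] by (rule image_subsetI)
    qed (rule finite_words)
    finally show ?thesis
      using sum_block_freq_le_1[of "Suc l" B] \<mu>.prob_le_1[of "\<Union>C\<in>{C. length C = Suc l}. cylinder X C"]
      by linarith
  qed
  \<comment> \<open>The exceptional sets of all words in \<open>W\<close> together then have measure
    less than \<open>s\<close>, also when \<open>W\<close> is empty.\<close>
  define \<eta> where "\<eta> = s / (1 + card W)"
  have \<eta>: "0 < \<eta>" "card W * \<eta> < s"
    using s by (auto simp: \<eta>_def field_simps)
  \<comment> \<open>Half of \<open>\<gamma>\<close> is reserved for the deviation of the visit rate,
    the other half for its difference from the block frequency.\<close>
  define Z where "Z n C = {x \<in> space \<mu>. \<gamma> / 2 \<le> \<bar>visit_rate n (cylinder X C) x - m (cylinder X C)\<bar>}"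
    for n C
  have Z_event: "Z n C \<in> sets \<mu>" for n C
    unfolding Z_def using \<mu>.visit_rate_measurable[OF cylinder_clopen] by measurable
  have "\<forall>\<^sub>F n in sequentially. \<forall>C\<in>W. measure \<mu> (Z n C) < \<eta> \<and> length C / n \<le> \<gamma> / 2"
  proof (intro eventually_ball_finite W(1) ballI eventually_conj)
    fix C assume "C \<in> W"
    show "\<forall>\<^sub>F n in sequentially. measure \<mu> (Z n C) < \<eta>"
    proof -
      obtain n0 where n0: "\<forall>n\<ge>n0. \<forall>E\<in>sets \<mu>.
          (\<forall>x\<in>E. \<gamma> / 2 \<le> \<bar>visit_rate n (cylinder X C) x - m (cylinder X C)\<bar>) \<longrightarrow> measure \<mu> E < \<eta>"
        using \<mu>.visit_rate_concentrates[OF cylinder_clopen, of "\<gamma> / 2" \<eta> C] W(3) \<eta>(1) by auto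
      show ?thesis
      proof (rule eventually_sequentiallyI)
        fix n assume "n0 \<le> n"
        moreover have "\<forall>x\<in>Z n C. \<gamma> / 2 \<le> \<bar>visit_rate n (cylinder X C) x - m (cylinder X C)\<bar>"
          by (simp add: Z_def)
        ultimately show "measure \<mu> (Z n C) < \<eta>" using n0 Z_event by blast
      qed
    qed
    have "(\<lambda>n. length C / real n) \<longlonglongrightarrow> 0" by (rule lim_const_over_n)
    then have "\<forall>\<^sub>F n in sequentially. length C / real n < \<gamma> / 2"
      using W(3) by (intro order_tendstoD) auto
    then show "\<forall>\<^sub>F n in sequentially. length C / real n \<le> \<gamma> / 2"
      by (rule eventually_mono) simp
  qed
  then have "\<forall>\<^sub>F n in sequentially. 0 < n \<and>
      (\<forall>C\<in>W. measure \<mu> (Z n C) < \<eta> \<and> length C / real n \<le> \<gamma> / 2)"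
    by (intro eventually_conj eventually_gt_at_top)
  then obtain n where n: "0 < n" "\<And>C. C \<in> W \<Longrightarrow> measure \<mu> (Z n C) < \<eta>"
      "\<And>C. C \<in> W \<Longrightarrow> length C / real n \<le> \<gamma> / 2"
    using eventually_happens'[OF sequentially_bot] by blast
  \<comment> \<open>The window of length \<open>n\<close> is itself a candidate in
    \<open>unvisited\<close>, so it lies outside \<open>U\<close> and thus at distance at least
    \<open>\<delta>\<close> from \<open>\<mu>\<close>; some word of \<open>W\<close> must witness
    this.\<close>
  have "?F n \<subseteq> (\<Union>C\<in>W. Z n C)"
  proof
    fix x assume x: "x \<in> ?F n"
    then have xX: "x \<in> X" and notU: "Inl (window x 0 n) \<notin> U"
      using n(1) by (auto simp: unvisited_def)
    have "window x 0 n \<in> blocks X"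
      unfolding blocks_def using xX n(1) by (intro CollectI exI[of _ x] exI[of _ 0] exI[of _ n]) simp
    then have "Inl (window x 0 n) \<in> blocks_and_measures X"
      unfolding blocks_and_measures_def by (rule InlI)
    then have "\<not> d_star X (Inr \<mu>) (Inl (window x 0 n)) < \<delta>" using \<delta>(2) notU by blast
    then obtain C where C: "C \<in> W"
      "\<not> \<bar>value_on X (Inr \<mu>) C - value_on X (Inl (window x 0 n)) C\<bar> < \<gamma>"
      using close sum_le_2 by blast
    then have "\<gamma> \<le> \<bar>m (cylinder X C) - block_freq (window x 0 n) C\<bar>"
      by (simp add: value_on_def \<mu>(4)[OF cylinder_clopen])
    moreover have "C \<noteq> []" using W(2) C(1) by blast
    then have "\<bar>visit_rate n (cylinder X C) x - block_freq (window x 0 n) C\<bar> \<le> \<gamma> / 2"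
      using visit_rate_cylinder_close[OF xX _ n(1), of C] n(3)[OF C(1)] by linarith
    ultimately have "\<gamma> / 2 \<le> \<bar>visit_rate n (cylinder X C) x - m (cylinder X C)\<bar>" by linarith
    then show "x \<in> (\<Union>C\<in>W. Z n C)" using C(1) xX \<mu>(2) by (auto simp: Z_def)
  qed
  then have "measure \<mu> (?F n) \<le> measure \<mu> (\<Union>C\<in>W. Z n C)"
    using Z_event W(1) by (intro \<mu>.finite_measure_mono) auto
  also have "\<dots> \<le> (\<Sum>C\<in>W. measure \<mu> (Z n C))"
    using W(1) Z_event by (intro measure_UNION_le) auto
  also have "\<dots> \<le> (\<Sum>C\<in>W. \<eta>)" using n(2) by (intro sum_mono less_imp_le)
  also have "\<dots> < s" using \<eta>(2) by simp
  finally show False using m(2)[of n] \<mu>(4)[OF unvisited_clopen] by simp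
qed

lemma long_blocks_decomposable:
  assumes "d_star_open X U" "Inr ` ergodic_measures X \<subseteq> U" "0 < \<epsilon>"
  shows "\<exists>n0. \<forall>B\<in>blocks X. length B \<ge> n0 \<longrightarrow> decomposable {B. Inl B \<in> U} \<epsilon> B"
proof (rule ccontr)
  assume "\<not> ?thesis"
  then have "\<exists>B\<in>blocks X. n0 \<le> length B \<and> \<not> decomposable {B. Inl B \<in> U} \<epsilon> B" for n0 by blast
  from undecomposable_limit[OF assms(3) this] obtain m where
    "m \<in> invariant_contents" "\<And>N. \<epsilon> / 2 \<le> m (unvisited {B. Inl B \<in> U} N)" by blast
  then show False using unvisited_not_charged[OF assms(1,2)] assms(3) by fastforce
qed

end

section \<open>One-sided and two-sided subshifts\<close>

lemma one_sided_configuration_system: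
  assumes "one_sided_subshift X"
  shows "configuration_system X"
proof
  show "closed X" "shift_map ` X \<subseteq> X" using assms by (simp_all add: one_sided_subshift_def)
  fix B assume "B \<in> blocks X"
  then obtain x i k where B: "x \<in> X" "B = window x i k" by (auto simp: blocks_def)
  have "(shift_map ^^ i) x \<in> X"
    using assms B(1) by (intro funpow_in_invariant) (auto simp: one_sided_subshift_def)
  moreover have "B = window ((shift_map ^^ i) x) 0 (length B)"
    unfolding B(2) by (simp add: window_def shift_map_funpow add_ac)
  ultimately show "\<exists>y\<in>X. B = window y 0 (length B)" by blast
qed

text \<open>A block at a negative coordinate is moved to 0 by a preimage under an iterate of the
  shift, which exists in \<open>X\<close> because the shift maps \<open>X\<close> onto
  itself.\<close>

lemma two_sided_configuration_system:
  assumes "two_sided_subshift X"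
  shows "configuration_system X"
proof
  show "closed X" using assms by (simp add: two_sided_subshift_def)
  show sub: "shift_map ` X \<subseteq> X" using assms by (simp add: two_sided_subshift_def)
  have orbit: "\<exists>y\<in>X. (shift_map ^^ j) y = x" if "x \<in> X" for j x
    using that
  proof (induction j arbitrary: x)
    case (Suc j)
    then obtain z where "z \<in> X" "x = shift_map z" using assms by (auto simp: two_sided_subshift_def)
    then show ?case using Suc.IH[of z] by auto
  qed auto
  fix B assume "B \<in> blocks X"
  then obtain x i k where B: "x \<in> X" "B = window x i k" by (auto simp: blocks_def)
  obtain y where y: "y \<in> X" "\<And>j. y j = x (i + j)"
  proof (cases "0 \<le> i")
    case True
    have "(shift_map ^^ nat i) x \<in> X" by (rule funpow_in_invariant[OF sub B(1)])
    then show thesis using True by (intro that) (auto simp: shift_map_funpow add_ac)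
  next
    case False
    obtain y where "y \<in> X" "(shift_map ^^ nat (- i)) y = x" using orbit[OF B(1)] by blast
    then show thesis using False by (intro that[of y]) (auto simp: shift_map_funpow)
  qed
  have "B = window y 0 (length B)" unfolding B(2) by (simp add: window_def y(2))
  then show "\<exists>y\<in>X. B = window y 0 (length B)" using y(1) by blast
qed

theorem theorem2p5:
  fixes X :: "(int \<Rightarrow> 'a::{finite,discrete_topology}) set"
    and Y :: "(nat \<Rightarrow> 'a) set"
  shows
    "(two_sided_subshift X \<longrightarrow>
       (\<forall>U. d_star_open X U \<and> Inr ` ergodic_measures X \<subseteq> U \<longrightarrow>
         (\<forall>\<epsilon>::real. \<epsilon> > 0 \<longrightarrow>
           (\<exists>n0::nat. \<forall>B \<in> blocks X. length B \<ge> n0 \<longrightarrow>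
             (\<exists>(r::nat) (A :: nat \<Rightarrow> 'a list) (E :: nat \<Rightarrow> 'a list).
                B = concat (map (\<lambda>j. A j @ E j) [1..<Suc r]) @ A (Suc r) \<and>
                (\<forall>j \<in> {1..r}. Inl (E j) \<in> U) \<and>
                real (\<Sum>j = 1..r. length (E j)) \<ge> (1 - \<epsilon>) * real (length B))))))
     \<and>
     (one_sided_subshift Y \<longrightarrow>
       (\<forall>U. d_star_open Y U \<and> Inr ` ergodic_measures Y \<subseteq> U \<longrightarrow>
         (\<forall>\<epsilon>::real. \<epsilon> > 0 \<longrightarrow>
           (\<exists>n0::nat. \<forall>B \<in> blocks Y. length B \<ge> n0 \<longrightarrow>
             (\<exists>(r::nat) (A :: nat \<Rightarrow> 'a list) (E :: nat \<Rightarrow> 'a list).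
                B = concat (map (\<lambda>j. A j @ E j) [1..<Suc r]) @ A (Suc r) \<and>
                (\<forall>j \<in> {1..r}. Inl (E j) \<in> U) \<and>
                real (\<Sum>j = 1..r. length (E j)) \<ge> (1 - \<epsilon>) * real (length B))))))"
proof -
  note main = configuration_system.long_blocks_decomposable
    [unfolded decomposable_def mem_Collect_eq]
  show ?thesis
    by (intro conjI impI allI; elim conjE)
      (rule main[OF two_sided_configuration_system] main[OF one_sided_configuration_system];
        assumption)+
qed

end
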